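(* Let $0<s<1$ and $\rho>0$. For any $f\in L^2(\gamma)$ with $U_sf\in L^2(\gamma)$, we have $$\left(\int_{\mathbb{R}^n}|f(x)|^2(\rho+|x|^2)^s\,d\gamma(x)\right)\langle U_sf,f\rangle_{L^2(\gamma)}\ \ge\ (2\rho)^s\,\frac{\Gamma\left(\frac{n/2+1+s}{2}\right)}{\Gamma\left(\frac{n/2+1-s}{2}\right)}\left(\int_{\mathbb{R}^n}|f(x)|^2\,d\gamma(x)\right)^2.$$
   Context: $\gamma(x)=\pi^{-n/2}e^{-|x|^2}$ on $\mathbb{R}^n$, $d\gamma(x)=\gamma(x)dx$, $L^2(\gamma)=L^2(\mathbb{R}^n,\gamma(x)dx)$. $L=-\Delta+2x\cdot\nabla+n$ is self-adjoint on $L^2(\gamma)$ with $L=\sum_{k=0}^\infty(2k+n)Q_k$, where $Q_k$ is the orthogonal projection onto the eigenspace with eigenvalue $2k+n$ (spanned by Hermite polynomials of degree $k$). $U=\frac12L$ and $$U_sf=\sum_{k=0}^\infty 2^s\frac{\Gamma\left(\frac{k+n/2+1+s}{2}\right)}{\Gamma\left(\frac{k+n/2+1-s}{2}\right)}Q_kf .$$ *)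

theory Defs
  imports "HOL-Analysis.Analysis" "HOL-Computational_Algebra.Polynomial"
begin

section \<open>The Gaussian measure and its \<open>L\<^sup>2\<close> space\<close>

definition gauss :: "(real ^ 'n) measure" where
  "gauss = density lborel
     (\<lambda>x. ennreal (pi powr (- real CARD('n) / 2) * exp (- (norm x)\<^sup>2)))"

text \<open>Elements of \<open>L\<^sup>2(\<gamma>)\<close> are represented by Borel functions; nothing below depends on the
  choice of the representative.\<close>

definition L2 :: "(real ^ 'n \<Rightarrow> complex) set" where
  "L2 = {f \<in> borel_measurable gauss. integrable gauss (\<lambda>x. (cmod (f x))\<^sup>2)}"

definition ip :: "(real ^ 'n \<Rightarrow> complex) \<Rightarrow> (real ^ 'n \<Rightarrow> complex) \<Rightarrow> complex" where
  "ip f g = (\<integral>x. f x * cnj (g x) \<partial>gauss)"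

section \<open>Hermite polynomials\<close>

text \<open>Physicists' normalisation, orthogonal for the weight \<open>exp (- x\<^sup>2)\<close>; see Rodrigues' formula
  below.\<close>

primrec hermite :: "nat \<Rightarrow> real poly" where
  "hermite 0 = 1"
| "hermite (Suc m) = [:0, 2:] * hermite m - pderiv (hermite m)"

lemma hermite_rodrigues:
  "(deriv ^^ m) (\<lambda>x::real. exp (- x\<^sup>2)) =
     (\<lambda>x. (-1) ^ m * poly (hermite m) x * exp (- x\<^sup>2))"
proof (induction m)
  case (Suc m)
  have "((\<lambda>x. (-1) ^ m * poly (hermite m) x * exp (- x\<^sup>2)) has_real_derivative
      (-1) ^ Suc m * poly (hermite (Suc m)) x * exp (- x\<^sup>2)) (at x)" for x :: real
    by (auto intro!: derivative_eq_intros poly_DERIV simp: algebra_simps)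
  then show ?case
    using Suc.IH by (auto intro!: ext DERIV_imp_deriv)
qed simp

lemma pderiv_hermite: "pderiv (hermite (Suc m)) = smult (2 * (1 + real m)) (hermite m)"
proof (induction m)
  case 0
  show ?case by (simp add: pderiv_pCons)
next
  case (Suc m)
  have "pderiv (hermite (Suc (Suc m))) =
      smult 2 (hermite (Suc m)) + [:0, 2:] * pderiv (hermite (Suc m))
        - pderiv (pderiv (hermite (Suc m)))"
    by (simp add: pderiv_diff pderiv_mult pderiv_pCons pderiv_smult
          hermite.simps(2)[of "Suc m"] del: hermite.simps(2))
  also have "\<dots> = smult 2 (hermite (Suc m))
      + smult (2 * (1 + real m)) ([:0, 2:] * hermite m - pderiv (hermite m))"
    unfolding Suc.IH by (simp add: pderiv_smult smult_diff_right)
  also have "\<dots> = smult (2 * (1 + real (Suc m))) (hermite (Suc m))"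
    unfolding hermite.simps(2)[symmetric] by (simp flip: smult_add_left del: hermite.simps)
  finally show ?case .
qed

lemma hermite_ode:
  "- pderiv (pderiv (hermite m)) + [:0, 2:] * pderiv (hermite m) = smult (2 * real m) (hermite m)"
proof (cases m)
  case (Suc j)
  show ?thesis
    unfolding Suc pderiv_hermite
    by (simp add: pderiv_smult smult_diff_right)
qed simp

definition hermite_mv :: "('n \<Rightarrow> nat) \<Rightarrow> real ^ 'n \<Rightarrow> real" where
  "hermite_mv \<alpha> x = (\<Prod>i\<in>UNIV. poly (hermite (\<alpha> i)) (x $ i))"

section \<open>The operator \<open>L\<close> and its eigenspaces\<close>

definition partial :: "'n \<Rightarrow> (real ^ 'n \<Rightarrow> complex) \<Rightarrow> real ^ 'n \<Rightarrow> complex" where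
  "partial i f x = vector_derivative (\<lambda>t. f (x + t *\<^sub>R axis i 1)) (at 0)"

definition L_op :: "(real ^ 'n \<Rightarrow> complex) \<Rightarrow> real ^ 'n \<Rightarrow> complex" where
  "L_op f x = - (\<Sum>i\<in>UNIV. partial i (partial i f) x)
     + 2 * (\<Sum>i\<in>UNIV. of_real (x $ i) * partial i f x) + of_nat CARD('n) * f x"

text \<open>The eigenspace of \<open>L\<close> for the eigenvalue \<open>2 * k + n\<close> is the complex span of the (finitely
  many) Hermite polynomials of total degree \<open>k\<close>; \<open>L_op_eigenspace\<close> below checks the eigenvalue
  equation.\<close>

definition eigenspace :: "nat \<Rightarrow> (real ^ 'n \<Rightarrow> complex) set" where
  "eigenspace k =
     range (\<lambda>c x. \<Sum>\<alpha> | (\<Sum>i\<in>UNIV. \<alpha> i) = k. c \<alpha> * of_real (hermite_mv \<alpha> x))"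

lemma hermite_mv_axis:
  "hermite_mv \<alpha> (x + t *\<^sub>R axis i 1) =
     poly (hermite (\<alpha> i)) (x $ i + t) * (\<Prod>j\<in>UNIV - {i}. poly (hermite (\<alpha> j)) (x $ j))"
  unfolding hermite_mv_def
  by (subst prod.remove[of _ i]) (auto simp: axis_def intro!: prod.cong)

lemma partial_poly:
  fixes F :: "'i \<Rightarrow> real poly" and G :: "'i \<Rightarrow> real ^ 'n \<Rightarrow> real"
  assumes "finite A" and "\<And>a x t. G a (x + t *\<^sub>R axis i 1) = G a x"
  shows "partial i (\<lambda>x. \<Sum>a\<in>A. c a * of_real (poly (F a) (x $ i) * G a x)) =
    (\<lambda>x. \<Sum>a\<in>A. c a * of_real (poly (pderiv (F a)) (x $ i) * G a x))"
proof
  fix x :: "real ^ 'n"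
  have 1: "((\<lambda>t. poly (F a) (x $ i + t)) has_real_derivative poly (pderiv (F a)) (x $ i)) (at 0)"
    for a
    using DERIV_chain2[OF poly_DERIV, of "\<lambda>t. x $ i + t" 1 0 UNIV "F a"]
    by (auto intro!: derivative_eq_intros)
  have 2: "((\<lambda>t. c a * of_real (poly (F a) (x $ i + t) * G a x)) has_vector_derivative
      c a * of_real (poly (pderiv (F a)) (x $ i) * G a x)) (at 0)" for a
    by (intro has_vector_derivative_mult_right has_vector_derivative_of_real
          has_real_derivative_iff_has_vector_derivative[THEN iffD1] DERIV_cmult_right 1)
  have "((\<lambda>t. \<Sum>a\<in>A. c a * of_real (poly (F a) (x $ i + t) * G a x)) has_vector_derivative
      (\<Sum>a\<in>A. c a * of_real (poly (pderiv (F a)) (x $ i) * G a x))) (at 0)"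
    by (intro has_vector_derivative_sum 2)
  then show "partial i (\<lambda>x. \<Sum>a\<in>A. c a * of_real (poly (F a) (x $ i) * G a x)) x =
      (\<Sum>a\<in>A. c a * of_real (poly (pderiv (F a)) (x $ i) * G a x))"
    unfolding partial_def assms(2) by (simp add: vector_derivative_at)
qed

lemma finite_multiindices: "finite {\<alpha> :: 'n::finite \<Rightarrow> nat. (\<Sum>i\<in>UNIV. \<alpha> i) = k}"
proof (rule finite_subset)
  show "{\<alpha> :: 'n \<Rightarrow> nat. (\<Sum>i\<in>UNIV. \<alpha> i) = k} \<subseteq> PiE UNIV (\<lambda>_. {..k})"
    by (auto intro: member_le_sum)
qed (auto intro: finite_PiE)

lemma L_op_eigenspace:
  fixes g :: "real ^ 'n \<Rightarrow> complex"
  assumes "g \<in> eigenspace k"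
  shows "L_op g x = of_nat (2 * k + CARD('n)) * g x"
proof -
  let ?A = "{\<alpha> :: 'n \<Rightarrow> nat. (\<Sum>i\<in>UNIV. \<alpha> i) = k}"
  obtain c where g: "g = (\<lambda>x. \<Sum>\<alpha>\<in>?A. c \<alpha> * of_real (hermite_mv \<alpha> x))"
    using assms by (auto simp: eigenspace_def)
  define G where "G i \<alpha> x = (\<Prod>j\<in>UNIV - {i}. poly (hermite (\<alpha> j)) (x $ j))"
    for i and \<alpha> :: "'n \<Rightarrow> nat" and x :: "real ^ 'n"
  have H: "hermite_mv \<alpha> x = poly (hermite (\<alpha> i)) (x $ i) * G i \<alpha> x" for \<alpha> i and x :: "real ^ 'n"
    using hermite_mv_axis[of \<alpha> x 0 i] by (simp add: G_def)
  have G: "G i \<alpha> (x + t *\<^sub>R axis i 1) = G i \<alpha> x" for i \<alpha> x t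
    unfolding G_def by (auto simp: axis_def intro!: prod.cong)
  have 1: "partial i g = (\<lambda>x. \<Sum>\<alpha>\<in>?A. c \<alpha> * of_real (poly (pderiv (hermite (\<alpha> i))) (x $ i) * G i \<alpha> x))"
    for i
    unfolding g H[of _ _ i] by (rule partial_poly[OF finite_multiindices G])
  have 2: "partial i (partial i g) =
      (\<lambda>x. \<Sum>\<alpha>\<in>?A. c \<alpha> * of_real (poly (pderiv (pderiv (hermite (\<alpha> i)))) (x $ i) * G i \<alpha> x))" for i
    unfolding 1 by (rule partial_poly[OF finite_multiindices G])
  have 3: "- poly (pderiv (pderiv (hermite m))) t + 2 * t * poly (pderiv (hermite m)) t
      = 2 * real m * poly (hermite m) t" for m t
    using arg_cong[OF hermite_ode[of m], of "\<lambda>p. poly p t"] by (simp add: algebra_simps)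
  have 4: "- partial i (partial i g) x + 2 * (of_real (x $ i) * partial i g x) =
      (\<Sum>\<alpha>\<in>?A. c \<alpha> * of_real (2 * real (\<alpha> i) * hermite_mv \<alpha> x))" for i
  proof -
    have "- partial i (partial i g) x + 2 * (of_real (x $ i) * partial i g x) =
      (\<Sum>\<alpha>\<in>?A. c \<alpha> * of_real ((- poly (pderiv (pderiv (hermite (\<alpha> i)))) (x $ i)
         + 2 * x $ i * poly (pderiv (hermite (\<alpha> i))) (x $ i)) * G i \<alpha> x))"
      unfolding 2 unfolding 1
      by (simp add: sum_distrib_left algebra_simps sum_subtractf sum.distrib)
    then show ?thesis unfolding 3 H[of _ x i] by (simp add: mult.assoc)
  qed
  have "L_op g x = (\<Sum>i\<in>UNIV. - partial i (partial i g) x + 2 * (of_real (x $ i) * partial i g x))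
      + of_nat CARD('n) * g x"
    unfolding L_op_def by (simp add: sum.distrib sum_distrib_left sum_negf sum_subtractf)
  also have "(\<Sum>i\<in>UNIV. - partial i (partial i g) x + 2 * (of_real (x $ i) * partial i g x)) =
      (\<Sum>\<alpha>\<in>?A. \<Sum>i\<in>UNIV. c \<alpha> * of_real (2 * real (\<alpha> i) * hermite_mv \<alpha> x))"
    unfolding 4 by (rule sum.swap)
  also have "\<dots> = (\<Sum>\<alpha>\<in>?A. c \<alpha> * of_real (2 * real k * hermite_mv \<alpha> x))"
  proof (rule sum.cong[OF refl])
    fix \<alpha> assume "\<alpha> \<in> ?A"
    then have "real k = (\<Sum>i\<in>UNIV. real (\<alpha> i))" by auto
    then show "(\<Sum>i\<in>UNIV. c \<alpha> * of_real (2 * real (\<alpha> i) * hermite_mv \<alpha> x)) =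
        c \<alpha> * of_real (2 * real k * hermite_mv \<alpha> x)"
      by (simp add: sum_distrib_left sum_distrib_right)
  qed
  also have "\<dots> = of_nat (2 * k) * g x"
    unfolding g by (simp add: sum_distrib_left algebra_simps)
  finally show ?thesis by (simp add: algebra_simps)
qed

section \<open>Spectral projections and fractional powers\<close>

text \<open>Orthogonal projection. The description is unique as functions (not only almost everywhere),
  because polynomials that agree almost everywhere are equal.\<close>

definition Q :: "nat \<Rightarrow> (real ^ 'n \<Rightarrow> complex) \<Rightarrow> real ^ 'n \<Rightarrow> complex" where
  "Q k f = (THE g. g \<in> eigenspace k \<and> (\<forall>h\<in>eigenspace k. ip (\<lambda>x. f x - g x) h = 0))"

text \<open>Here \<open>d\<close> is the dimension of the underlying space.\<close>

definition U_coeff :: "nat \<Rightarrow> real \<Rightarrow> nat \<Rightarrow> real" where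
  "U_coeff d s k = 2 powr s * Gamma ((real k + real d / 2 + 1 + s) / 2)
                            / Gamma ((real k + real d / 2 + 1 - s) / 2)"

text \<open>\<open>has_U s f u\<close>: the series defining \<open>U\<^sub>s f\<close> converges in \<open>L\<^sup>2(\<gamma>)\<close>, with sum \<open>u\<close>, i.e.
  \<open>U\<^sub>s f \<in> L\<^sup>2(\<gamma>)\<close> and \<open>u\<close> represents it.\<close>

definition has_U :: "real \<Rightarrow> (real ^ 'n \<Rightarrow> complex) \<Rightarrow> (real ^ 'n \<Rightarrow> complex) \<Rightarrow> bool" where
  "has_U s f u \<longleftrightarrow> u \<in> L2 \<and>
     (\<lambda>N. \<integral>\<^sup>+x. ennreal ((cmod (u x - (\<Sum>k<N. of_real (U_coeff CARD('n) s k) * Q k f x)))\<^sup>2) \<partial>gauss)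
       \<longlonglongrightarrow> 0"

end

theory Submission
  imports Defs "HOL-Probability.Distributions"
begin

text \<open>
The inequality is the product of two lower bounds. On the one hand \<open>(\<rho> + (norm x)\<^sup>2) powr s\<close> is at
least \<open>\<rho> powr s\<close>, so the weighted integral is at least \<open>\<rho> powr s\<close> times the squared norm of \<open>f\<close>. On
the other hand the multiplier \<open>U_coeff n s k\<close> increases with \<open>k\<close>, because \<open>Gamma\<close> is logarithmically
convex (\<open>Gamma_ratio_mono\<close>), and therefore the quadratic form of \<open>U\<^sub>s\<close> is at least the lowest
multiplier \<open>U_coeff n s 0\<close> times the squared norm of \<open>f\<close> (\<open>ip_U_ge\<close>). The product of the two
constants is the one in the theorem.

The second bound needs the spectral theorem for the operator: the inner product of \<open>u\<close> and \<open>f\<close> is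
the sum of the multipliers times the squared norms of the \<open>Q k f\<close>, and these squared norms add up to
that of \<open>f\<close>. The first part is the orthogonality of the Hermite polynomials
(\<open>hermite_mv_orthogonal\<close>), which makes the projections \<open>Q k\<close> explicit (\<open>Q_eq\<close>). The second part is
their completeness in \<open>L\<^sup>2(\<gamma>)\<close> (\<open>L2_subset_hermite_closure\<close>), which is most of the work.

For completeness, let \<open>D\<close> be the closed span of the Hermite polynomials. It contains all polynomials
and is closed under pointwise limits that are dominated by a square integrable function
(\<open>hermite_closure_limit\<close>). Expanding \<open>exp (- (norm x)\<^sup>2 / 4)\<close> into its Taylor series repeatedly
shows that \<open>D\<close> contains all polynomials times powers of this function. The map
\<open>x \<mapsto> (exp (- (norm x)\<^sup>2 / 4) *\<^sub>R x, exp (- (norm x)\<^sup>2 / 4))\<close> is injective with bounded range, and \<open>D\<close>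
contains all polynomials in its components; by the Weierstrass theorem \<open>D\<close> contains every
continuous function of them. Dominated limits then lead to indicator functions of compact, closed
and Borel sets, and finally to all of \<open>L\<^sup>2(\<gamma>)\<close>.
\<close>

section \<open>Product integrals over Euclidean space\<close>

text \<open>Lebesgue measure on a Euclidean space is by construction the image of a product measure indexed by
the orthonormal basis; re-indexing the basis by the coordinates gives Fubini for functions that
are products of functions of one coordinate each.\<close>

lemma has_bochner_integral_prod_vec:
  fixes f :: "'n::finite \<Rightarrow> real \<Rightarrow> real"
  assumes f: "\<And>i. has_bochner_integral lborel (f i) (c i)"
  shows "has_bochner_integral lborel (\<lambda>x::real^'n. \<Prod>i\<in>UNIV. f i (x $ i)) (\<Prod>i\<in>UNIV. c i)"
proof -
  interpret product_sigma_finite "\<lambda>_::real^'n. lborel :: real measure"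
    by standard
  \<comment> \<open>\<open>ix\<close> recovers the coordinate from a basis vector.\<close>
  define ix where "ix = inv (\<lambda>i::'n. axis i (1::real))"
  have inj: "inj (\<lambda>i::'n. axis i (1::real))"
    by (auto simp: inj_on_def axis_eq_axis)
  then have ix: "ix (axis i 1) = i" for i
    unfolding ix_def by (rule inv_f_f)
  have Basis: "(Basis :: (real^'n) set) = range (\<lambda>i. axis i 1)"
    by (auto simp: Basis_vec_def)
  have reindex: "(\<Prod>b\<in>Basis. g b) = (\<Prod>i\<in>UNIV. g (axis i 1))" for g :: "real^'n \<Rightarrow> real"
    unfolding Basis by (simp add: prod.reindex[OF inj])
  let ?T = "\<lambda>y. \<Sum>b\<in>Basis. y b *\<^sub>R b :: real^'n"
  have coord: "?T y $ i = y (axis i 1)" for y i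
    by (simp add: cart_eq_inner_axis inner_sum_left inner_Basis if_distrib Basis cong: if_cong)
  have eq: "(\<lambda>y. \<Prod>i\<in>UNIV. f i (?T y $ i)) = (\<lambda>y. \<Prod>b\<in>Basis. f (ix b) (y b))"
    unfolding coord reindex ix ..
  have int: "integrable lborel (f i)" for i using f[of i] by (simp add: has_bochner_integral_iff)
  then have [measurable]: "f i \<in> borel_measurable borel" for i
    using borel_measurable_integrable by fastforce
  have T: "?T \<in> borel_measurable (\<Pi>\<^sub>M b\<in>(Basis::(real^'n) set). lborel)"
    by measurable
  have F: "(\<lambda>x::real^'n. \<Prod>i\<in>UNIV. f i (x $ i)) \<in> borel_measurable borel"
    by measurable
  show ?thesis
    unfolding has_bochner_integral_iff
  proof
    show "integrable lborel (\<lambda>x::real^'n. \<Prod>i\<in>UNIV. f i (x $ i))"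
      unfolding lborel_eq[where 'a="real^'n"] integrable_distr_eq[OF T F] eq
      by (intro product_integrable_prod int) auto
    have "(\<integral>x. (\<Prod>i\<in>UNIV. f i ((x::real^'n) $ i)) \<partial>lborel)
      = (\<integral>y. (\<Prod>b\<in>Basis. f (ix b) (y b)) \<partial>(\<Pi>\<^sub>M b\<in>(Basis::(real^'n) set). lborel))"
      unfolding lborel_eq[where 'a="real^'n"] integral_distr[OF T F] eq ..
    also have "\<dots> = (\<Prod>b\<in>(Basis::(real^'n) set). integral\<^sup>L lborel (f (ix b)))"
      by (intro product_integral_prod int) auto
    also have "\<dots> = (\<Prod>i\<in>UNIV. c i)"
      unfolding reindex ix using f by (simp add: has_bochner_integral_iff)
    finally show "(\<integral>x. (\<Prod>i\<in>UNIV. f i ((x::real^'n) $ i)) \<partial>lborel) = (\<Prod>i\<in>UNIV. c i)" .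
  qed
qed

lemma integrable_exp_neg_norm_sq:
  assumes "c > 0"
  shows "integrable lborel (\<lambda>x::real^'n. exp (- c * (norm x)\<^sup>2))"
proof -
  \<comment> \<open>The variance \<open>1 / (2 * c)\<close> matches the rate \<open>c\<close>.\<close>
  have "(\<lambda>t. normal_density 0 (sqrt (1 / (2 * c))) t / sqrt (c / pi)) = (\<lambda>t. exp (- c * t\<^sup>2))"
    using assms by (auto simp: normal_density_def real_sqrt_divide fun_eq_iff real_sqrt_mult field_simps)
  then have 1: "integrable lborel (\<lambda>t. exp (- c * t\<^sup>2))"
    using integrable_normal_density[of "sqrt (1 / (2 * c))" 0] assms
    by (metis integrable_divide_zero real_sqrt_gt_0_iff zero_less_divide_1_iff zero_less_mult_iff zero_less_numeral)
  have "has_bochner_integral lborel (\<lambda>x::real^'n. \<Prod>i\<in>UNIV. exp (- c * (x $ i)\<^sup>2))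
      (\<Prod>i\<in>(UNIV::'n set). \<integral>t. exp (- c * t\<^sup>2) \<partial>lborel)"
    by (intro has_bochner_integral_prod_vec has_bochner_integral_integrable 1)
  then show ?thesis
    by (simp add: has_bochner_integral_iff exp_sum[symmetric] sum_distrib_left norm_vec_def L2_set_def
        sum_nonneg sum_negf)
qed

section \<open>Gaussian moments and Hermite polynomials in one variable\<close>

definition gauss1 :: "real \<Rightarrow> real" where
  "gauss1 t = exp (- t\<^sup>2) / sqrt pi"

lemma gauss1_normal: "gauss1 = normal_density 0 (1 / sqrt 2)"
  by (simp add: gauss1_def normal_density_def fun_eq_iff power_divide)

lemma integrable_gauss1_power: "integrable lborel (\<lambda>t. gauss1 t * t ^ k)"
  using integrable_normal_moment[of "1 / sqrt 2" 0 k] by (simp add: gauss1_normal)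

text \<open>This is integration by parts against the weight \<open>exp (- t\<^sup>2)\<close> for monomials. It is read off
the closed form of the Gaussian moments, so that no boundary terms at infinity arise.\<close>

lemma gauss1_moment_rec: "(k + 1) * (\<integral>t. gauss1 t * t ^ k \<partial>lborel) = 2 * (\<integral>t. gauss1 t * t ^ (k + 2) \<partial>lborel)"
proof (cases "even k")
  case True
  then obtain j where k: "k = 2 * j" by (auto elim: evenE)
  have e: "(\<integral>t. gauss1 t * t ^ (2 * i) \<partial>lborel) = fact (2 * i) / (4 ^ i * fact i)" for i
    using integral_normal_moment_even[of "1 / sqrt 2" 0 i] by (simp add: gauss1_normal power_divide)
  show ?thesis
  proof -
    have "fact (2 * Suc j) = 2 * (real j + 1) * ((2 * real j + 1) * fact (2 * j))"
      and "4 ^ Suc j * fact (Suc j) = 2 * (real j + 1) * (2 * (4 ^ j * fact j))"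
      by (simp_all add: algebra_simps)
    then have "2 * (fact (2 * Suc j) / (4 ^ Suc j * fact (Suc j)) :: real)
        = (real k + 1) * (fact (2 * j) / (4 ^ j * fact j))"
      by (simp add: k del: power_Suc fact_Suc mult_Suc_right)
    then show ?thesis
      using e[of j] e[of "Suc j"] by (simp add: k)
  qed
next
  case False
  then obtain j where k: "k = 2 * j + 1" by (auto elim: oddE)
  have e: "(\<integral>t. gauss1 t * t ^ (2 * i + 1) \<partial>lborel) = 0" for i
    using integral_normal_moment_odd[of "1 / sqrt 2" 0 i] by (simp add: gauss1_normal)
  show ?thesis
    using e[of j] e[of "Suc j"] by (simp add: k)
qed

lemma integrable_gauss1_poly: "integrable lborel (\<lambda>t. gauss1 t * poly p t)"
proof -
  have "(\<lambda>t. gauss1 t * poly p t) = (\<lambda>t. \<Sum>i\<le>degree p. coeff p i * (gauss1 t * t ^ i))"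
    by (simp add: poly_altdef sum_distrib_left fun_eq_iff mult_ac)
  then show ?thesis by (simp add: integrable_gauss1_power)
qed

definition gauss1_mean :: "real poly \<Rightarrow> real" where
  "gauss1_mean p = (\<integral>t. gauss1 t * poly p t \<partial>lborel)"

lemma gauss1_mean_simps [simp]:
  "gauss1_mean (p + q) = gauss1_mean p + gauss1_mean q"
  "gauss1_mean (p - q) = gauss1_mean p - gauss1_mean q"
  "gauss1_mean (smult a p) = a * gauss1_mean p"
  "gauss1_mean 0 = 0"
  using integrable_gauss1_poly[of p] integrable_gauss1_poly[of q]
  by (simp_all add: gauss1_mean_def algebra_simps) (simp flip: mult.assoc mult.commute[of a])?

lemma gauss1_mean_monom: "gauss1_mean (monom c k) = c * (\<integral>t. gauss1 t * t ^ k \<partial>lborel)"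
proof -
  have "gauss1_mean (monom c k) = (\<integral>t. c * (gauss1 t * t ^ k) \<partial>lborel)"
    by (simp add: gauss1_mean_def poly_monom mult_ac)
  then show ?thesis by simp
qed

text \<open>Both sides are linear in the polynomial, so the moment recursion for monomials suffices. The
identity says that multiplication by \<open>2 * t\<close> minus differentiation, which is the step that raises
the degree of a Hermite polynomial, is adjoint to differentiation.\<close>

lemma gauss1_mean_pderiv: "gauss1_mean (pderiv p) = gauss1_mean ([:0, 2:] * p)"
proof -
  have m: "gauss1_mean (pderiv (monom c k)) = gauss1_mean ([:0, 2:] * monom c k)" for c k
  proof -
    have "[:0, 2:] * monom c k = monom (2 * c) (Suc k)"
      by (simp add: monom_Suc smult_monom)
    moreover have "(\<integral>t. gauss1 t * t \<partial>lborel) = 0"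
      using integral_normal_moment_odd[of "1 / sqrt 2" 0 0] by (simp add: gauss1_normal)
    ultimately show ?thesis
      using gauss1_moment_rec[of "k - 1"]
      by (cases k) (simp_all add: pderiv_monom gauss1_mean_monom, (simp add: algebra_simps)?)
  qed
  have "gauss1_mean (pderiv (\<Sum>i\<in>A. monom (coeff p i) i)) = gauss1_mean ([:0, 2:] * (\<Sum>i\<in>A. monom (coeff p i) i))"
    if "finite A" for A
    using that
  proof induction
    case (insert i A)
    then show ?case
      by (simp only: sum.insert[OF insert.hyps] pderiv_add distrib_left gauss1_mean_simps m insert.IH)
  qed simp
  from this[of "{..degree p}"] show ?thesis
    by (simp add: poly_as_sum_of_monoms)
qed

lemma gauss1_mean_hermite_Suc: "gauss1_mean (hermite (Suc m) * p) = gauss1_mean (hermite m * pderiv p)"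
proof -
  have "hermite (Suc m) * p = [:0, 2:] * (hermite m * p) - pderiv (hermite m) * p"
    by (simp add: algebra_simps)
  then have "gauss1_mean (hermite (Suc m) * p) =
    gauss1_mean (pderiv (hermite m * p)) - gauss1_mean (pderiv (hermite m) * p)"
    by (simp only: gauss1_mean_simps gauss1_mean_pderiv)
  then show ?thesis
    by (simp add: pderiv_mult mult.commute)
qed

lemma gauss1_mean_1: "gauss1_mean 1 = 1"
  using integral_normal_moment_even[of "1 / sqrt 2" 0 0] by (simp add: gauss1_mean_def gauss1_normal)

text \<open>The raising step on one factor is a differentiation of the other one, which lowers its degree by
one at the price of the factor \<open>2 * l\<close>. Iterating this, one of the two factors reaches degree
zero first unless the degrees agree, and then the derivative of a constant appears.\<close>

lemma hermite_orthogonal: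
  "gauss1_mean (hermite m * hermite l) = (if m = l then 2 ^ m * fact m else 0)"
proof (induction m arbitrary: l)
  case 0
  show ?case
  proof (cases l)
    case 0
    then show ?thesis by (simp add: gauss1_mean_1)
  next
    case (Suc j)
    then show ?thesis
      using gauss1_mean_hermite_Suc[of j 1] by (simp del: hermite.simps(2) add: mult.commute)
  qed
next
  case (Suc m)
  show ?case
  proof (cases l)
    case 0
    then show ?thesis by (simp only: gauss1_mean_hermite_Suc) simp
  next
    case (Suc j)
    show ?thesis
      unfolding gauss1_mean_hermite_Suc Suc pderiv_hermite mult_smult_right gauss1_mean_simps Suc.IH
      by simp
  qed
qed

section \<open>Hermite polynomials in several variables\<close>

lemma space_gauss [simp]: "space gauss = UNIV"
  by (simp add: gauss_def)

lemma sets_gauss [simp, measurable_cong]: "sets gauss = sets borel"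
  by (simp add: gauss_def)

lemma measurable_gauss_iff: "f \<in> borel_measurable gauss \<longleftrightarrow> f \<in> borel_measurable borel"
  by (subst measurable_cong_sets[OF sets_gauss refl]) (rule refl)

lemma gauss_density_prod:
  "pi powr (- real CARD('n) / 2) * exp (- (norm x)\<^sup>2) = (\<Prod>i\<in>UNIV. gauss1 (x $ i))"
  for x :: "real ^ 'n"
proof -
  have "pi powr (- real CARD('n) / 2) = (pi powr (- 1 / 2)) powr real CARD('n)"
    by (simp add: powr_powr)
  also have "pi powr (- 1 / 2) = 1 / sqrt pi"
    using powr_half_sqrt[of pi] powr_minus_divide[of pi "1/2"] by simp
  also have "(1 / sqrt pi) powr real CARD('n) = (1 / sqrt pi) ^ CARD('n)"
    by (rule powr_realpow) simp
  finally have 1: "pi powr (- real CARD('n) / 2) = (1 / sqrt pi) ^ CARD('n)" .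
  have "(norm x)\<^sup>2 = (\<Sum>i\<in>UNIV. (x $ i)\<^sup>2)"
    by (simp add: norm_vec_def L2_set_def sum_nonneg)
  then have 2: "exp (- (norm x)\<^sup>2) = (\<Prod>i\<in>UNIV. exp (- (x $ i)\<^sup>2))"
    by (simp flip: exp_sum sum_negf)
  have "(\<Prod>i\<in>UNIV. gauss1 (x $ i)) = (\<Prod>i\<in>UNIV. (1 / sqrt pi) * exp (- (x $ i)\<^sup>2))"
    by (simp add: gauss1_def)
  also have "\<dots> = (1 / sqrt pi) ^ CARD('n) * (\<Prod>i\<in>UNIV. exp (- (x $ i)\<^sup>2))"
    by (simp only: prod.distrib prod_constant)
  finally show ?thesis unfolding 1 2 ..
qed

lemma has_bochner_integral_gauss:
  fixes f :: "real ^ 'n \<Rightarrow> real"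
  assumes "f \<in> borel_measurable borel"
    and "has_bochner_integral lborel (\<lambda>x. (\<Prod>i\<in>UNIV. gauss1 (x $ i)) * f x) c"
  shows "has_bochner_integral gauss f c"
proof -
  have *: "gauss1 t \<ge> 0" for t by (simp add: gauss1_def)
  have [measurable]: "gauss1 \<in> borel_measurable borel"
    unfolding gauss1_def by measurable
  show ?thesis
    unfolding gauss_def gauss_density_prod
    by (rule has_bochner_integral_density) (use assms * in \<open>auto intro: prod_nonneg\<close>)
qed

definition hermite_sqnorm :: "('n::finite \<Rightarrow> nat) \<Rightarrow> real" where
  "hermite_sqnorm \<alpha> = (\<Prod>i\<in>UNIV. 2 ^ \<alpha> i * fact (\<alpha> i))"

lemma hermite_sqnorm_pos: "hermite_sqnorm \<alpha> > 0"
  unfolding hermite_sqnorm_def by (rule prod_pos) simp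

lemma hermite_mv_measurable [measurable]: "hermite_mv \<alpha> \<in> borel_measurable borel"
proof -
  have "continuous_on UNIV (hermite_mv \<alpha>)"
    unfolding hermite_mv_def[abs_def] by (intro continuous_intros)
  then show ?thesis by (rule borel_measurable_continuous_onI)
qed

lemma hermite_mv_orthogonal:
  fixes \<alpha> \<beta> :: "'n::finite \<Rightarrow> nat"
  shows "has_bochner_integral gauss (\<lambda>x. hermite_mv \<alpha> x * hermite_mv \<beta> x)
    (if \<alpha> = \<beta> then hermite_sqnorm \<alpha> else 0)"
proof -
  let ?f = "\<lambda>i t. gauss1 t * poly (hermite (\<alpha> i) * hermite (\<beta> i)) t"
  have "has_bochner_integral lborel (?f i) (gauss1_mean (hermite (\<alpha> i) * hermite (\<beta> i)))" for i
    unfolding gauss1_mean_def by (intro has_bochner_integral_integrable integrable_gauss1_poly)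
  then have "has_bochner_integral lborel (\<lambda>x::real^'n. \<Prod>i\<in>UNIV. ?f i (x $ i))
      (\<Prod>i\<in>UNIV. gauss1_mean (hermite (\<alpha> i) * hermite (\<beta> i)))"
    by (rule has_bochner_integral_prod_vec)
  also have "(\<lambda>x::real^'n. \<Prod>i\<in>UNIV. ?f i (x $ i))
      = (\<lambda>x. (\<Prod>i\<in>UNIV. gauss1 (x $ i)) * (hermite_mv \<alpha> x * hermite_mv \<beta> x))"
    by (simp add: hermite_mv_def prod.distrib fun_eq_iff)
  also have "(\<Prod>i\<in>UNIV. gauss1_mean (hermite (\<alpha> i) * hermite (\<beta> i)))
      = (if \<alpha> = \<beta> then hermite_sqnorm \<alpha> else 0)"
    by (auto simp: hermite_orthogonal hermite_sqnorm_def fun_eq_iff)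
  finally show ?thesis
    by (rule has_bochner_integral_gauss[rotated]) measurable
qed

section \<open>The space of square integrable functions for the Gaussian measure\<close>

lemma integrable_gauss_exp:
  assumes "c < 1"
  shows "integrable gauss (\<lambda>x::real^'n. exp (c * (norm x)\<^sup>2))"
proof -
  have "integrable lborel (\<lambda>x::real^'n. pi powr (- real CARD('n) / 2) * exp (- (1 - c) * (norm x)\<^sup>2))"
    using assms by (intro integrable_mult_right integrable_exp_neg_norm_sq) simp
  also have "(\<lambda>x::real^'n. pi powr (- real CARD('n) / 2) * exp (- (1 - c) * (norm x)\<^sup>2))
      = (\<lambda>x. (\<Prod>i\<in>UNIV. gauss1 (x $ i)) * exp (c * (norm x)\<^sup>2))"
    by (simp add: fun_eq_iff gauss_density_prod[symmetric] exp_add[symmetric] algebra_simps mult.assoc)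
  finally have *: "integrable lborel (\<lambda>x::real^'n. (\<Prod>i\<in>UNIV. gauss1 (x $ i)) * exp (c * (norm x)\<^sup>2))" .
  show ?thesis
    using has_bochner_integral_gauss[OF _ has_bochner_integral_integrable[OF *]]
    by (simp add: has_bochner_integral_iff)
qed

lemma integrable_gauss_const [simp]: "integrable gauss (\<lambda>x::real^'n. c :: real)"
  using integrable_mult_right[OF integrable_gauss_exp[of 0], of c] by simp

definition nsq :: "(real ^ 'n \<Rightarrow> complex) \<Rightarrow> real" where
  "nsq f = (\<integral>x. (cmod (f x))\<^sup>2 \<partial>gauss)"

lemma L2_D: "f \<in> L2 \<Longrightarrow> f \<in> borel_measurable borel"
  by (simp add: L2_def measurable_gauss_iff)

lemma L2_integrable: "f \<in> L2 \<Longrightarrow> integrable gauss (\<lambda>x. (cmod (f x))\<^sup>2)"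
  by (simp add: L2_def)

lemma L2_dominated:
  assumes "f \<in> borel_measurable borel" "integrable gauss (\<lambda>x. (w x)\<^sup>2)" "\<And>x. cmod (f x) \<le> w x"
  shows "f \<in> L2"
proof -
  have [measurable]: "f \<in> borel_measurable borel" by fact
  have "(cmod (f x))\<^sup>2 \<le> (w x)\<^sup>2" for x
    using assms(3) by (intro power_mono) auto
  then have "integrable gauss (\<lambda>x. (cmod (f x))\<^sup>2)"
    by (intro Bochner_Integration.integrable_bound[OF assms(2)]) (auto simp: measurable_gauss_iff)
  then show ?thesis by (simp add: L2_def measurable_gauss_iff assms(1))
qed

lemma cmod_add_sq_le: "(cmod (a + b))\<^sup>2 \<le> 2 * (cmod a)\<^sup>2 + 2 * (cmod b)\<^sup>2"
proof -
  have "(cmod (a + b))\<^sup>2 \<le> (cmod a + cmod b)\<^sup>2"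
    by (intro power_mono norm_triangle_ineq) auto
  also have "\<dots> \<le> 2 * (cmod a)\<^sup>2 + 2 * (cmod b)\<^sup>2"
    using sum_squares_bound[of "cmod a" "cmod b"] by (simp add: power2_sum)
  finally show ?thesis .
qed

lemma L2_add:
  assumes f: "f \<in> L2" and g: "g \<in> L2"
  shows "(\<lambda>x. f x + g x) \<in> L2"
proof -
  have [measurable]: "f \<in> borel_measurable borel" "g \<in> borel_measurable borel"
    using f g by (auto dest: L2_D)
  have "integrable gauss (\<lambda>x. (cmod (f x + g x))\<^sup>2)"
  proof (rule Bochner_Integration.integrable_bound)
    show "integrable gauss (\<lambda>x. 2 * (cmod (f x))\<^sup>2 + 2 * (cmod (g x))\<^sup>2)"
      using f g by (simp add: L2_integrable)
  qed (auto simp: measurable_gauss_iff cmod_add_sq_le)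
  then show ?thesis by (simp add: L2_def measurable_gauss_iff)
qed

lemma L2_cmult:
  assumes "f \<in> L2"
  shows "(\<lambda>x. c * f x) \<in> L2"
proof -
  have "(\<lambda>x. c * f x) \<in> borel_measurable gauss"
    using assms by (intro borel_measurable_times borel_measurable_const) (simp add: L2_def)
  moreover have "integrable gauss (\<lambda>x. (cmod c)\<^sup>2 * (cmod (f x))\<^sup>2)"
    by (rule integrable_mult_right) (use assms in \<open>simp add: L2_def\<close>)
  ultimately show ?thesis
    by (simp add: L2_def norm_mult power_mult_distrib del: integrable_mult_right_iff)
qed

lemma L2_diff:
  assumes "f \<in> L2" "g \<in> L2"
  shows "(\<lambda>x. f x - g x) \<in> L2"
  using L2_add[OF assms(1) L2_cmult[OF assms(2), of "-1"]] by simp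

lemma L2_sum: "(\<And>i. i \<in> I \<Longrightarrow> f i \<in> L2) \<Longrightarrow> (\<lambda>x. \<Sum>i\<in>I. f i x) \<in> L2"
proof (induction I rule: infinite_finite_induct)
  case (insert i I)
  then have "(\<lambda>x. f i x + (\<Sum>i\<in>I. f i x)) \<in> L2"
    by (intro L2_add) blast+
  with insert.hyps show ?case by simp
qed (simp_all add: L2_def)

lemma integrable_ip:
  assumes f: "f \<in> L2" and g: "g \<in> L2"
  shows "integrable gauss (\<lambda>x. f x * cnj (g x))"
proof (rule Bochner_Integration.integrable_bound)
  show "integrable gauss (\<lambda>x. (cmod (f x))\<^sup>2 + (cmod (g x))\<^sup>2)"
    using f g by (simp add: L2_integrable)
  have [measurable]: "f \<in> borel_measurable borel" "g \<in> borel_measurable borel"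
    using f g by (auto dest: L2_D)
  have "continuous_on UNIV cnj" by (intro continuous_intros)
  then have [measurable]: "cnj \<in> borel_measurable borel" by (rule borel_measurable_continuous_onI)
  show "(\<lambda>x. f x * cnj (g x)) \<in> borel_measurable gauss"
    by measurable
  have "a * b \<le> a\<^sup>2 + b\<^sup>2" if "a \<ge> 0" "b \<ge> 0" for a b :: real
    using sum_squares_bound[of a b] that mult_nonneg_nonneg[OF that] by linarith
  then show "AE x in gauss. norm (f x * cnj (g x)) \<le> norm ((cmod (f x))\<^sup>2 + (cmod (g x))\<^sup>2)"
    by (simp add: norm_mult)
qed

lemma nsq_nonneg: "nsq f \<ge> 0"
  by (simp add: nsq_def)

lemma nsq_cmult: "nsq (\<lambda>x. c * f x) = (cmod c)\<^sup>2 * nsq f"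
  unfolding nsq_def norm_mult power_mult_distrib by (rule integral_mult_right_zero)

lemma nsq_add_le:
  assumes f: "f \<in> L2" and g: "g \<in> L2"
  shows "nsq (\<lambda>x. f x + g x) \<le> 2 * nsq f + 2 * nsq g"
proof -
  have "nsq (\<lambda>x. f x + g x) \<le> (\<integral>x. 2 * (cmod (f x))\<^sup>2 + 2 * (cmod (g x))\<^sup>2 \<partial>gauss)"
    unfolding nsq_def
  proof (rule integral_mono)
    show "integrable gauss (\<lambda>x. (cmod (f x + g x))\<^sup>2)"
      using L2_integrable[OF L2_add[OF f g]] .
    show "integrable gauss (\<lambda>x. 2 * (cmod (f x))\<^sup>2 + 2 * (cmod (g x))\<^sup>2)"
      using L2_integrable[OF f] L2_integrable[OF g] by simp
  qed (rule cmod_add_sq_le)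
  then show ?thesis
    using f g by (simp add: nsq_def L2_integrable)
qed

section \<open>Polynomials are linear combinations of Hermite polynomials\<close>

definition hermite_span :: "(real ^ 'n \<Rightarrow> complex) set" where
  "hermite_span = {g. \<exists>A c. finite A \<and> g = (\<lambda>x. \<Sum>\<alpha>\<in>A. c \<alpha> * of_real (hermite_mv \<alpha> x))}"

lemma hermite_span_hermite: "(\<lambda>x. of_real (hermite_mv \<alpha> x)) \<in> hermite_span"
  unfolding hermite_span_def by (intro CollectI exI[of _ "{\<alpha>}"] exI[of _ "\<lambda>_. 1"]) simp

lemma hermite_span_cmult:
  assumes "f \<in> hermite_span"
  shows "(\<lambda>x. c * f x) \<in> hermite_span"
proof -
  obtain A d where "finite A" "f = (\<lambda>x. \<Sum>\<alpha>\<in>A. d \<alpha> * of_real (hermite_mv \<alpha> x))"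
    using assms by (auto simp: hermite_span_def)
  then show ?thesis
    unfolding hermite_span_def
    by (intro CollectI exI[of _ A] exI[of _ "\<lambda>\<alpha>. c * d \<alpha>"]) (simp add: sum_distrib_left mult_ac)
qed

lemma hermite_span_add:
  assumes "f \<in> hermite_span" "g \<in> hermite_span"
  shows "(\<lambda>x. f x + g x) \<in> hermite_span"
proof -
  obtain A c B d where f: "finite A" "f = (\<lambda>x. \<Sum>\<alpha>\<in>A. c \<alpha> * of_real (hermite_mv \<alpha> x))"
    and g: "finite B" "g = (\<lambda>x. \<Sum>\<alpha>\<in>B. d \<alpha> * of_real (hermite_mv \<alpha> x))"
    using assms unfolding hermite_span_def by blast
  define e where "e \<alpha> = (if \<alpha> \<in> A then c \<alpha> else 0) + (if \<alpha> \<in> B then d \<alpha> else 0)" for \<alpha>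
  have "f x = (\<Sum>\<alpha>\<in>A \<union> B. (if \<alpha> \<in> A then c \<alpha> else 0) * of_real (hermite_mv \<alpha> x))"
    and "g x = (\<Sum>\<alpha>\<in>A \<union> B. (if \<alpha> \<in> B then d \<alpha> else 0) * of_real (hermite_mv \<alpha> x))" for x
    using f g by (auto intro!: sum.mono_neutral_cong_left)
  then have "(\<lambda>x. f x + g x) = (\<lambda>x. \<Sum>\<alpha>\<in>A \<union> B. e \<alpha> * of_real (hermite_mv \<alpha> x))"
    by (simp add: e_def distrib_right sum.distrib)
  with f g show ?thesis unfolding hermite_span_def by blast
qed

lemma hermite_span_sum:
  "(\<And>i. i \<in> I \<Longrightarrow> f i \<in> hermite_span) \<Longrightarrow> (\<lambda>x. \<Sum>i\<in>I. f i x) \<in> hermite_span"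
proof (induction I rule: infinite_finite_induct)
  case (insert i I) then show ?case by (simp add: hermite_span_add)
qed (use hermite_span_cmult[OF hermite_span_hermite, of 0] in simp_all)

lemma hermite_recurrence:
  "t * poly (hermite m) t = poly (hermite (Suc m)) t / 2 + real m * poly (hermite (m - 1)) t"
proof (cases m)
  case (Suc j)
  have "poly (hermite (Suc (Suc j))) t
      = 2 * t * poly (hermite (Suc j)) t - 2 * (1 + real j) * poly (hermite j) t"
    by (subst hermite.simps(2)) (simp add: pderiv_hermite del: hermite.simps)
  then show ?thesis by (simp add: Suc algebra_simps del: hermite.simps)
qed simp

lemma hermite_span_coordinate:
  assumes "f \<in> hermite_span"
  shows "(\<lambda>x. of_real (x $ i) * f x) \<in> hermite_span"
proof -
  have 1: "(\<lambda>x. of_real (x $ i * hermite_mv \<alpha> x) :: complex) \<in> hermite_span" for \<alpha>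
  proof -
    define G where "G x = (\<Prod>j\<in>UNIV - {i}. poly (hermite (\<alpha> j)) (x $ j))" for x
    have H: "hermite_mv (\<alpha>(i := m)) x = poly (hermite m) (x $ i) * G x" for x m
      using hermite_mv_axis[of "\<alpha>(i := m)" x 0 i] by (simp add: G_def)
    have "x $ i * hermite_mv \<alpha> x = 1 / 2 * hermite_mv (\<alpha>(i := Suc (\<alpha> i))) x
        + real (\<alpha> i) * hermite_mv (\<alpha>(i := \<alpha> i - 1)) x" for x
    proof -
      have "x $ i * hermite_mv \<alpha> x = (x $ i * poly (hermite (\<alpha> i)) (x $ i)) * G x"
        using H[of "\<alpha> i" x] by simp
      then show ?thesis
        unfolding hermite_recurrence H by (simp add: algebra_simps del: hermite.simps(2))
    qed
    then show ?thesis
      by (simp only: of_real_add of_real_mult)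
         (intro hermite_span_add hermite_span_cmult hermite_span_hermite)
  qed
  obtain A c where f: "f = (\<lambda>x. \<Sum>\<alpha>\<in>A. c \<alpha> * of_real (hermite_mv \<alpha> x))"
    using assms by (auto simp: hermite_span_def)
  have "(\<lambda>x. of_real (x $ i) * f x) = (\<lambda>x. \<Sum>\<alpha>\<in>A. c \<alpha> * of_real (x $ i * hermite_mv \<alpha> x))"
    by (simp add: f sum_distrib_left mult_ac)
  then show ?thesis
    using 1 by (simp only:) (intro hermite_span_sum hermite_span_cmult)
qed

lemma bounded_linear_vec_expansion:
  fixes f :: "real ^ 'n \<Rightarrow> real"
  assumes "bounded_linear f"
  shows "f x = (\<Sum>i\<in>UNIV. f (axis i 1) * (x $ i))"
proof -
  interpret bounded_linear f by fact
  have "x = (\<Sum>i\<in>UNIV. (x $ i) *\<^sub>R axis i 1)"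
    by (simp add: vec_eq_iff axis_def if_distrib cong: if_cong)
  then have "f x = f (\<Sum>i\<in>UNIV. (x $ i) *\<^sub>R axis i 1)" by simp
  then show ?thesis by (simp add: sum scaleR mult.commute)
qed

text \<open>By the three-term recurrence the span is a module over the coordinate functions, hence over all
polynomial functions. Phrasing the result as closure under multiplication lets the induction pass
through products of polynomials.\<close>

lemma hermite_span_polynomial_mult:
  assumes "real_polynomial_function q" "f \<in> hermite_span"
  shows "(\<lambda>x. of_real (q x) * f x) \<in> hermite_span"
  using assms
proof (induction arbitrary: f)
  case (linear l)
  have "(\<lambda>x. of_real (l x) * f x) = (\<lambda>x. \<Sum>i\<in>UNIV. of_real (l (axis i 1)) * (of_real (x $ i) * f x))"
    by (subst bounded_linear_vec_expansion[OF linear(1)]) (simp add: sum_distrib_right mult.assoc)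
  then show ?case
    using linear(2)
    by (simp only:) (intro hermite_span_sum hermite_span_cmult hermite_span_coordinate)
next
  case (mult p q)
  show ?case using mult.IH(1)[OF mult.IH(2)[OF mult.prems]] by (simp add: mult.assoc)
qed (simp_all add: hermite_span_cmult hermite_span_add distrib_right)

lemma hermite_span_polynomial:
  assumes "real_polynomial_function q"
  shows "(\<lambda>x::real^'n. of_real (q x)) \<in> hermite_span"
  using hermite_span_polynomial_mult[OF assms hermite_span_hermite[of "\<lambda>_. 0"]]
  by (simp add: hermite_mv_def)

section \<open>Polynomials and exponentials in the closed span\<close>

text \<open>The rate \<open>e\<close> is arbitrary so that it can be divided between the two factors of a product.\<close>

lemma real_polynomial_function_bound:
  fixes q :: "real ^ 'n \<Rightarrow> real"
  assumes "real_polynomial_function q" "e > 0"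
  obtains C where "\<And>x. \<bar>q x\<bar> \<le> C * exp (e * (norm x)\<^sup>2)"
proof -
  have "\<exists>C. \<forall>x. \<bar>q x\<bar> \<le> C * exp (e * (norm x)\<^sup>2)"
    using assms
  proof (induction arbitrary: e)
    case (linear l)
    then obtain K where K: "\<And>x. \<bar>l x\<bar> \<le> norm x * K" "K \<ge> 0"
      using bounded_linear.nonneg_bounded[of l] by auto
    have "norm x \<le> exp (1 / (4 * e)) * exp (e * (norm x)\<^sup>2)" for x :: "real^'n"
    proof -
      have "norm x \<le> 1 / (4 * e) + e * (norm x)\<^sup>2"
        using linear.prems zero_le_power2[of "2 * e * norm x - 1"]
        by (simp add: field_simps power2_eq_square)
      also have "\<dots> \<le> exp (1 / (4 * e) + e * (norm x)\<^sup>2)"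
        using exp_ge_add_one_self[of "1 / (4 * e) + e * (norm x)\<^sup>2"] by linarith
      finally show ?thesis by (simp add: exp_add)
    qed
    then have "norm x * K \<le> exp (1 / (4 * e)) * exp (e * (norm x)\<^sup>2) * K" for x :: "real^'n"
      using K(2) by (intro mult_right_mono)
    from order_trans[OF K(1) this] have "\<bar>l x\<bar> \<le> K * exp (1 / (4 * e)) * exp (e * (norm x)\<^sup>2)" for x
      by (simp add: mult_ac)
    then show ?case by blast
  next
    case (const c)
    have "\<bar>c\<bar> \<le> \<bar>c\<bar> * exp (e * (norm x)\<^sup>2)" for x :: "real^'n"
      using const mult_left_mono[of 1 "exp (e * (norm x)\<^sup>2)" "\<bar>c\<bar>"] by simp
    then show ?case by blast
  next
    case (add p q)
    obtain C D where "\<And>x. \<bar>p x\<bar> \<le> C * exp (e * (norm x)\<^sup>2)" "\<And>x. \<bar>q x\<bar> \<le> D * exp (e * (norm x)\<^sup>2)"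
      using add.IH(1)[OF add.prems] add.IH(2)[OF add.prems] by blast
    then have "\<bar>p x + q x\<bar> \<le> (C + D) * exp (e * (norm x)\<^sup>2)" for x
      unfolding distrib_right by (intro order_trans[OF abs_triangle_ineq] add_mono)
    then show ?case by blast
  next
    case (mult p q)
    obtain C D where "\<And>x. \<bar>p x\<bar> \<le> C * exp (e / 2 * (norm x)\<^sup>2)" "\<And>x. \<bar>q x\<bar> \<le> D * exp (e / 2 * (norm x)\<^sup>2)"
      using mult.IH(1)[of "e/2"] mult.IH(2)[of "e/2"] mult.prems half_gt_zero by blast
    then have "\<bar>p x\<bar> * \<bar>q x\<bar> \<le> (C * exp (e / 2 * (norm x)\<^sup>2)) * (D * exp (e / 2 * (norm x)\<^sup>2))" for x
      by (intro mult_mono) (auto intro: order_trans[OF abs_ge_zero])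
    also have "(C * exp (e / 2 * (norm x)\<^sup>2)) * (D * exp (e / 2 * (norm x)\<^sup>2))
        = C * D * exp (e * (norm x)\<^sup>2)" for x :: "real^'n"
      by (simp add: exp_add[symmetric] algebra_simps)
    finally show ?case by (auto simp: abs_mult)
  qed
  then show ?thesis using that by blast
qed

lemma borel_measurable_polynomial:
  fixes q :: "real ^ 'n \<Rightarrow> real"
  shows "real_polynomial_function q \<Longrightarrow> q \<in> borel_measurable borel"
  by (intro borel_measurable_continuous_onI continuous_on_polymonial_function)
     (simp add: real_polynomial_function_eq)

text \<open>Such functions dominate the Taylor sums of \<open>exp (- (norm x)\<^sup>2 / 4)\<close> times a polynomial. The square
grows at the rate \<open>1/2\<close> in the exponent; the polynomial costs another \<open>1/4\<close>, which still leaves a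
rate below that of the Gaussian weight.\<close>

lemma integrable_polynomial_exp_square:
  fixes q :: "real ^ 'n \<Rightarrow> real"
  assumes "real_polynomial_function q"
  shows "integrable gauss (\<lambda>x. (q x * exp ((norm x)\<^sup>2 / 4))\<^sup>2)"
proof -
  have [measurable]: "q \<in> borel_measurable borel"
    using assms by (rule borel_measurable_polynomial)
  obtain C where C: "\<And>x. \<bar>q x\<bar> \<le> C * exp (1/8 * (norm x)\<^sup>2)"
    using real_polynomial_function_bound[OF assms, of "1/8"] by auto
  have "(q x * exp ((norm x)\<^sup>2 / 4))\<^sup>2 \<le> C\<^sup>2 * exp (3/4 * (norm x)\<^sup>2)" for x
  proof -
    have "\<bar>q x\<bar> * exp ((norm x)\<^sup>2 / 4) \<le> C * exp (1/8 * (norm x)\<^sup>2) * exp ((norm x)\<^sup>2 / 4)"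
      by (intro mult_right_mono C) simp
    also have "\<dots> \<le> \<bar>C\<bar> * exp (1/8 * (norm x)\<^sup>2) * exp ((norm x)\<^sup>2 / 4)"
      by (intro mult_right_mono) auto
    finally have "\<bar>q x * exp ((norm x)\<^sup>2 / 4)\<bar> \<le> \<bar>C * exp (3/8 * (norm x)\<^sup>2)\<bar>"
      by (simp add: abs_mult mult.assoc exp_add[symmetric] algebra_simps)
    then have "(q x * exp ((norm x)\<^sup>2 / 4))\<^sup>2 \<le> (C * exp (3/8 * (norm x)\<^sup>2))\<^sup>2"
      by (simp only: abs_le_square_iff)
    then show ?thesis
      by (simp add: power_mult_distrib exp_of_nat_mult[symmetric] algebra_simps)
  qed
  then show ?thesis
    by (intro Bochner_Integration.integrable_bound[OF integrable_mult_right[OF integrable_gauss_exp[of "3/4"], of "C\<^sup>2"]])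
       (auto simp: measurable_gauss_iff)
qed

lemma hermite_L2: "(\<lambda>x. of_real (hermite_mv \<alpha> x)) \<in> L2"
proof -
  have "(\<lambda>x. of_real (hermite_mv \<alpha> x) :: complex) \<in> borel_measurable borel"
    by measurable
  moreover have "integrable gauss (\<lambda>x. hermite_mv \<alpha> x * hermite_mv \<alpha> x)"
    using hermite_mv_orthogonal[of \<alpha> \<alpha>] unfolding has_bochner_integral_iff by blast
  ultimately show ?thesis
    by (simp add: L2_def measurable_gauss_iff power2_eq_square)
qed

lemma hermite_span_L2:
  assumes "g \<in> hermite_span"
  shows "g \<in> L2"
proof -
  obtain A c where g: "g = (\<lambda>x. \<Sum>\<alpha>\<in>A. c \<alpha> * of_real (hermite_mv \<alpha> x))"
    using assms unfolding hermite_span_def by blast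
  show ?thesis
    unfolding g by (rule L2_sum, rule L2_cmult, rule hermite_L2)
qed

text \<open>The closure of the span in \<open>L\<^sup>2(\<gamma>)\<close>. The density argument uses only that it
is a linear space that contains the polynomials and is closed under dominated pointwise limits.\<close>

definition hermite_closure :: "(real ^ 'n \<Rightarrow> complex) set" where
  "hermite_closure = {f \<in> L2. \<forall>e>0. \<exists>g\<in>hermite_span. nsq (\<lambda>x. f x - g x) < e}"

lemma hermite_closure_L2: "f \<in> hermite_closure \<Longrightarrow> f \<in> L2"
  by (simp add: hermite_closure_def)

lemma hermite_span_closure: "f \<in> hermite_span \<Longrightarrow> f \<in> hermite_closure"
  unfolding hermite_closure_def
  by (auto simp: hermite_span_L2 nsq_def intro!: bexI[of _ f])

lemma hermite_closureI:
  assumes "f \<in> L2" and "\<And>e. e > 0 \<Longrightarrow> \<exists>g\<in>hermite_closure. nsq (\<lambda>x. f x - g x) < e"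
  shows "f \<in> hermite_closure"
proof -
  have "\<exists>g\<in>hermite_span. nsq (\<lambda>x. f x - g x) < e" if e: "e > 0" for e
  proof -
    obtain h where h: "h \<in> hermite_closure" "nsq (\<lambda>x. f x - h x) < e / 4"
      using assms(2)[of "e / 4"] e by auto
    then obtain g where g: "g \<in> hermite_span" "nsq (\<lambda>x. h x - g x) < e / 4"
      using e unfolding hermite_closure_def by (auto dest: spec[of _ "e / 4"])
    have "nsq (\<lambda>x. (f x - h x) + (h x - g x)) \<le> 2 * nsq (\<lambda>x. f x - h x) + 2 * nsq (\<lambda>x. h x - g x)"
      by (intro nsq_add_le L2_diff assms(1) hermite_closure_L2 hermite_span_closure h g)
    with h g show ?thesis by (intro bexI[of _ g]) auto
  qed
  then show ?thesis using assms(1) by (simp add: hermite_closure_def)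
qed

lemma hermite_closure_add:
  assumes f: "f \<in> hermite_closure" and g: "g \<in> hermite_closure"
  shows "(\<lambda>x. f x + g x) \<in> hermite_closure"
proof (rule hermite_closureI)
  show "(\<lambda>x. f x + g x) \<in> L2" using f g by (intro L2_add hermite_closure_L2)
  fix e :: real assume e: "e > 0"
  obtain p where p: "p \<in> hermite_span" "nsq (\<lambda>x. f x - p x) < e / 4"
    using f e unfolding hermite_closure_def by (auto dest: spec[of _ "e / 4"])
  obtain q where q: "q \<in> hermite_span" "nsq (\<lambda>x. g x - q x) < e / 4"
    using g e unfolding hermite_closure_def by (auto dest: spec[of _ "e / 4"])
  have "nsq (\<lambda>x. (f x - p x) + (g x - q x)) \<le> 2 * nsq (\<lambda>x. f x - p x) + 2 * nsq (\<lambda>x. g x - q x)"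
    by (intro nsq_add_le L2_diff hermite_closure_L2 hermite_span_closure f g p q)
  with p q have "nsq (\<lambda>x. f x + g x - (p x + q x)) < e"
    by (simp add: algebra_simps)
  then show "\<exists>h\<in>hermite_closure. nsq (\<lambda>x. f x + g x - h x) < e"
    using hermite_span_closure[OF hermite_span_add[OF p(1) q(1)]]
    by (intro bexI[of _ "\<lambda>x. p x + q x"])
qed

lemma hermite_closure_cmult:
  assumes f: "f \<in> hermite_closure"
  shows "(\<lambda>x. c * f x) \<in> hermite_closure"
proof (rule hermite_closureI)
  show "(\<lambda>x. c * f x) \<in> L2" using f by (intro L2_cmult hermite_closure_L2)
  fix e :: real assume e: "e > 0"
  define d where "d = e / ((cmod c)\<^sup>2 + 1)"
  have c1: "(cmod c)\<^sup>2 + 1 > 0"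
    using zero_le_power2[of "cmod c"] by linarith
  then have d: "d > 0" "d * ((cmod c)\<^sup>2 + 1) = e"
    using e by (auto simp: d_def)
  obtain p where p: "p \<in> hermite_span" "nsq (\<lambda>x. f x - p x) < d"
    using f d(1) unfolding hermite_closure_def by blast
  have "nsq (\<lambda>x. c * f x - c * p x) = (cmod c)\<^sup>2 * nsq (\<lambda>x. f x - p x)"
    using nsq_cmult[of c "\<lambda>x. f x - p x"] by (simp add: algebra_simps)
  also have "\<dots> \<le> (cmod c)\<^sup>2 * d"
    using p by (intro mult_left_mono) auto
  also have "\<dots> < e"
    using d by (simp add: algebra_simps)
  finally show "\<exists>h\<in>hermite_closure. nsq (\<lambda>x. c * f x - h x) < e"
    using hermite_span_closure[OF hermite_span_cmult[OF p(1), of c]]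
    by (intro bexI[of _ "\<lambda>x. c * p x"])
qed

lemma hermite_closure_sum:
  "(\<And>i. i \<in> I \<Longrightarrow> f i \<in> hermite_closure) \<Longrightarrow> (\<lambda>x. \<Sum>i\<in>I. f i x) \<in> hermite_closure"
proof (induction I rule: infinite_finite_induct)
  case (insert i I)
  then have "(\<lambda>x. f i x + (\<Sum>i\<in>I. f i x)) \<in> hermite_closure"
    by (intro hermite_closure_add) blast+
  with insert.hyps show ?case by simp
qed (use hermite_closure_cmult[OF hermite_span_closure[OF hermite_span_hermite], of 0] in simp_all)

lemma hermite_closure_limit:
  fixes w :: "real ^ 'n \<Rightarrow> real"
  assumes F: "\<And>k. F k \<in> hermite_closure"
    and lim: "\<And>x. (\<lambda>k. F k x) \<longlonglongrightarrow> f x"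
    and bound: "\<And>k x. cmod (F k x) \<le> w x"
    and w: "integrable gauss (\<lambda>x. (w x)\<^sup>2)"
  shows "f \<in> hermite_closure"
proof -
  have [measurable]: "F k \<in> borel_measurable borel" for k
    using L2_D[OF hermite_closure_L2[OF F]] .
  have [measurable]: "f \<in> borel_measurable borel"
    by (rule borel_measurable_LIMSEQ_metric[where f=F]) (auto intro: lim)
  have fw: "cmod (f x) \<le> w x" for x
    by (rule Lim_bounded[OF tendsto_norm[OF lim[of x]], of 0]) (auto intro: bound)
  have f: "f \<in> L2"
    by (rule L2_dominated[OF _ w fw]) measurable
  have "(\<lambda>k. \<integral>x. (cmod (f x - F k x))\<^sup>2 \<partial>gauss) \<longlonglongrightarrow> (\<integral>x. 0 \<partial>(gauss :: (real^'n) measure))"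
  proof (rule integral_dominated_convergence)
    show "integrable gauss (\<lambda>x. 4 * (w x)\<^sup>2)" using w by simp
    show "AE x in gauss. norm ((cmod (f x - F k x))\<^sup>2) \<le> 4 * (w x)\<^sup>2" for k
    proof (rule AE_I2)
      fix x
      have "cmod (f x - F k x) \<le> 2 * w x"
        using norm_triangle_ineq4[of "f x" "F k x"] fw[of x] bound[of k x] by linarith
      then have "(cmod (f x - F k x))\<^sup>2 \<le> (2 * w x)\<^sup>2"
        by (intro power_mono) auto
      then show "norm ((cmod (f x - F k x))\<^sup>2) \<le> 4 * (w x)\<^sup>2"
        by (simp add: power_mult_distrib)
    qed
    show "AE x in gauss. (\<lambda>k. (cmod (f x - F k x))\<^sup>2) \<longlonglongrightarrow> 0"
    proof (rule AE_I2)
      fix x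
      have "(\<lambda>k. (cmod (f x - F k x))\<^sup>2) \<longlonglongrightarrow> (cmod (f x - f x))\<^sup>2"
        by (intro tendsto_intros lim)
      then show "(\<lambda>k. (cmod (f x - F k x))\<^sup>2) \<longlonglongrightarrow> 0" by simp
    qed
  qed (simp_all add: measurable_gauss_iff)
  then have *: "(\<lambda>k. nsq (\<lambda>x. f x - F k x)) \<longlonglongrightarrow> 0"
    by (simp add: nsq_def)
  show ?thesis
  proof (rule hermite_closureI[OF f])
    fix e :: real assume "e > 0"
    then have "eventually (\<lambda>k. nsq (\<lambda>x. f x - F k x) < e) sequentially"
      using * by (simp add: order_tendstoD)
    then obtain k where "nsq (\<lambda>x. f x - F k x) < e"
      using eventually_happens'[OF sequentially_bot] by blast
    then show "\<exists>g\<in>hermite_closure. nsq (\<lambda>x. f x - g x) < e"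
      using F by blast
  qed
qed

text \<open>Any rate below \<open>1/2\<close> would serve here: the Taylor sums of \<open>gexp\<close> are then dominated by a function
whose square is integrable against the weight \<open>exp (- (norm x)\<^sup>2)\<close>.\<close>

definition gexp :: "real ^ 'n \<Rightarrow> real" where
  "gexp x = exp (- (norm x)\<^sup>2 / 4)"

lemma exp_partial_sum_bound: "\<bar>\<Sum>j<M. y ^ j / fact j\<bar> \<le> exp \<bar>y :: real\<bar>"
proof -
  have s: "(\<lambda>j. \<bar>y\<bar> ^ j / fact j) sums exp \<bar>y\<bar>"
    using exp_converges[of "\<bar>y\<bar>"] by (simp add: field_simps)
  have "\<bar>\<Sum>j<M. y ^ j / fact j\<bar> \<le> (\<Sum>j<M. \<bar>y ^ j / fact j\<bar>)" by (rule sum_abs)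
  also have "\<dots> = (\<Sum>j<M. \<bar>y\<bar> ^ j / fact j)" by (simp add: power_abs)
  also have "\<dots> \<le> exp \<bar>y\<bar>"
    using sum_le_suminf[OF sums_summable[OF s], of "{..<M}"] sums_unique[OF s] by simp
  finally show ?thesis .
qed

lemma polynomial_norm_sq: "real_polynomial_function (\<lambda>x::real^'n. (norm x)\<^sup>2)"
proof -
  have "(\<lambda>x::real^'n. (norm x)\<^sup>2) = (\<lambda>x. \<Sum>i\<in>UNIV. (x $ i)\<^sup>2)"
    by (simp add: norm_vec_def L2_set_def sum_nonneg)
  then show ?thesis
    by (simp only:) (intro real_polynomial_function_sum real_polynomial_function_power
        real_polynomial_function.intros(1) bounded_linear_vec_nth finite)
qed

text \<open>One factor \<open>gexp\<close> is gained at a time: replacing it by its Taylor sums gives a polynomial times the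
previous power, and these sums converge under a fixed square integrable bound. A direct expansion
of \<open>gexp x ^ k\<close> would only have such a bound for \<open>k < 2\<close>.\<close>

lemma hermite_closure_polynomial_gexp:
  fixes q :: "real ^ 'n \<Rightarrow> real"
  assumes "real_polynomial_function q"
  shows "(\<lambda>x. of_real (q x * gexp x ^ k)) \<in> hermite_closure"
  using assms
proof (induction k arbitrary: q)
  case 0
  then show ?case by (simp add: hermite_span_closure hermite_span_polynomial)
next
  case (Suc k)
  let ?y = "\<lambda>x::real^'n. - (norm x)\<^sup>2 / 4"
  let ?F = "\<lambda>M x. of_real ((q x * (\<Sum>j<M. ?y x ^ j / fact j)) * gexp x ^ k) :: complex"
  have y: "real_polynomial_function ?y"
    by (intro real_polynomial_function_divide real_polynomial_function_minus polynomial_norm_sq)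
  have p: "real_polynomial_function (\<lambda>x. q x * (\<Sum>j<M. ?y x ^ j / fact j))" for M
    by (intro real_polynomial_function.intros(4) real_polynomial_function_sum
        real_polynomial_function_divide real_polynomial_function_power Suc.prems y) simp
  have g1: "gexp x ^ k \<le> 1" for x :: "real^'n"
    unfolding gexp_def by (intro power_le_one) auto
  have g0: "gexp x > 0" for x :: "real^'n"
    by (simp add: gexp_def)
  show ?case
  proof (rule hermite_closure_limit[where F="?F" and w="\<lambda>x. \<bar>q x\<bar> * exp ((norm x)\<^sup>2 / 4)"])
    show "?F M \<in> hermite_closure" for M
      by (rule Suc.IH[OF p])
    show "(\<lambda>M. ?F M x) \<longlonglongrightarrow> of_real (q x * gexp x ^ Suc k)" for x
    proof -
      have "(\<lambda>M. \<Sum>j<M. ?y x ^ j / fact j) \<longlonglongrightarrow> exp (?y x)"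
        using exp_converges[of "?y x"] by (simp add: sums_def field_simps)
      then have "(\<lambda>M. ?F M x) \<longlonglongrightarrow> of_real ((q x * exp (?y x)) * gexp x ^ k)"
        by (intro tendsto_intros)
      then show ?thesis by (simp add: gexp_def mult_ac)
    qed
    show "cmod (?F M x) \<le> \<bar>q x\<bar> * exp ((norm x)\<^sup>2 / 4)" for M x
    proof -
      have "cmod (?F M x) = \<bar>q x\<bar> * \<bar>\<Sum>j<M. ?y x ^ j / fact j\<bar> * gexp x ^ k"
        using g0[of x] by (simp only: norm_of_real abs_mult power_abs abs_of_pos)
      also have "\<dots> \<le> \<bar>q x\<bar> * exp \<bar>?y x\<bar> * 1"
        by (intro mult_mono exp_partial_sum_bound g1) (use g0[of x] in auto)
      finally show ?thesis by simp
    qed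
    show "integrable gauss (\<lambda>x. (\<bar>q x\<bar> * exp ((norm x)\<^sup>2 / 4))\<^sup>2)"
      using integrable_polynomial_exp_square[OF Suc.prems] by (simp add: power_mult_distrib)
  qed
qed

section \<open>Density of the Hermite polynomials\<close>

text \<open>A continuous injection into a bounded set. It turns the Weierstrass theorem on a compact set into
an approximation that is uniform on all of \<open>\<real>\<^sup>n\<close>: a polynomial in the components of \<open>gauss_embed x\<close>
is a sum of polynomials in \<open>x\<close> times powers of \<open>gexp x\<close>, which is in the closed span.\<close>

definition gauss_embed :: "real ^ 'n \<Rightarrow> (real ^ 'n) \<times> real" where
  "gauss_embed x = (gexp x *\<^sub>R x, gexp x)"

text \<open>The algebra generated by the polynomials and \<open>gexp\<close>, presented through sums only: it is a module
over each component of \<open>gauss_embed\<close>, which is what the induction over polynomials below uses.\<close>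

inductive_set gexp_poly :: "(real ^ 'n \<Rightarrow> real) set" where
  base: "real_polynomial_function q \<Longrightarrow> (\<lambda>x. q x * gexp x ^ k) \<in> gexp_poly"
| add: "g \<in> gexp_poly \<Longrightarrow> h \<in> gexp_poly \<Longrightarrow> (\<lambda>x. g x + h x) \<in> gexp_poly"

lemma gexp_poly_closure:
  "g \<in> gexp_poly \<Longrightarrow> (\<lambda>x. of_real (g x)) \<in> hermite_closure"
proof (induction rule: gexp_poly.induct)
  case (base q k)
  then show ?case by (rule hermite_closure_polynomial_gexp)
next
  case (add g h)
  show ?case using hermite_closure_add[OF add.IH] by simp
qed

lemma gexp_poly_mult:
  assumes "g \<in> gexp_poly" "real_polynomial_function q"
  shows "(\<lambda>x. q x * gexp x ^ k * g x) \<in> gexp_poly"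
  using assms(1)
proof (induction rule: gexp_poly.induct)
  case (base p j)
  have "(\<lambda>x. q x * p x * gexp x ^ (k + j)) \<in> gexp_poly"
    using base assms(2) by (intro gexp_poly.base real_polynomial_function.intros(4))
  then show ?case by (simp add: power_add mult_ac)
next
  case (add g h)
  show ?case using gexp_poly.add[OF add.IH] by (simp add: algebra_simps)
qed

lemma gexp_poly_embed:
  fixes p :: "(real ^ 'n) \<times> real \<Rightarrow> real"
  assumes "real_polynomial_function p" "g \<in> gexp_poly"
  shows "(\<lambda>x. p (gauss_embed x) * g x) \<in> gexp_poly"
  using assms
proof (induction arbitrary: g)
  case prems: (linear l)
  interpret bounded_linear l by (rule prems(1))
  have "l (gauss_embed x) = l (x, 1) * gexp x ^ 1" for x :: "real^'n"
    using scale[of "gexp x" "(x, 1)"] by (simp add: gauss_embed_def)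
  moreover have "real_polynomial_function (\<lambda>x::real^'n. l (x, 1))"
  proof -
    have eq: "(\<lambda>x::real^'n. l (x, 1)) = (\<lambda>x. l (x, 0) + l (0, 1))"
    proof
      show "l (x, 1) = l (x, 0) + l (0, 1)" for x :: "real^'n"
        using add[of "(x, 0)" "(0, 1)"] by simp
    qed
    have "bounded_linear (\<lambda>x::real^'n. l (x, 0))"
      by (intro bounded_linear_compose[OF prems(1)] bounded_linear_Pair
          bounded_linear_ident bounded_linear_zero)
    then show ?thesis
      unfolding eq by (intro real_polynomial_function.intros(1-3))
  qed
  ultimately show ?case
    using gexp_poly_mult[OF prems(2), of "\<lambda>x. l (x, 1)" 1] by simp
next
  case (const c)
  show ?case using gexp_poly_mult[OF const, of "\<lambda>x. c" 0] by (simp add: real_polynomial_function.intros(2))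
next
  case (add p q)
  show ?case using gexp_poly.add[OF add.IH(1)[OF add.prems] add.IH(2)[OF add.prems]]
    by (simp add: distrib_right)
next
  case (mult p q)
  show ?case using mult.IH(1)[OF mult.IH(2)[OF mult.prems]] by (simp add: mult.assoc)
qed

lemma hermite_closure_polynomial_embed:
  assumes "real_polynomial_function p"
  shows "(\<lambda>x::real^'n. of_real (p (gauss_embed x))) \<in> hermite_closure"
  using gexp_poly_closure[OF gexp_poly_embed[OF assms gexp_poly.base[of "\<lambda>_. 1" 0]]]
  by (simp add: real_polynomial_function.intros(2))

lemma gauss_embed_bounded: "gauss_embed x \<in> cball 0 2"
proof -
  have "norm x \<le> 1 + (norm x)\<^sup>2 / 4"
    using zero_le_power2[of "norm x / 2 - 1"] by (simp add: power2_eq_square algebra_simps)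
  also have "\<dots> \<le> exp ((norm x)\<^sup>2 / 4)"
    by (rule exp_ge_add_one_self)
  finally have "norm x * gexp x \<le> exp ((norm x)\<^sup>2 / 4) * gexp x"
    by (intro mult_right_mono) (auto simp: gexp_def)
  then have "norm (gexp x *\<^sub>R x) \<le> 1"
    by (simp add: gexp_def exp_add[symmetric] mult.commute)
  moreover have "norm (gexp x) \<le> 1" by (simp add: gexp_def)
  moreover have "norm (gauss_embed x) \<le> norm (gexp x *\<^sub>R x) + norm (gexp x)"
    unfolding gauss_embed_def by (rule norm_Pair_le)
  ultimately show ?thesis by simp
qed

lemma hermite_closure_continuous_embed:
  fixes G :: "(real ^ 'n) \<times> real \<Rightarrow> real"
  assumes G: "continuous_on UNIV G"
  shows "(\<lambda>x::real^'n. of_real (G (gauss_embed x))) \<in> hermite_closure"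
proof -
  let ?K = "cball 0 2 :: ((real ^ 'n) \<times> real) set"
  have cont: "continuous_on ?K G" using G by (rule continuous_on_subset) simp
  then have "bounded (G ` ?K)"
    by (intro compact_imp_bounded compact_continuous_image compact_cball)
  then obtain B where B: "\<And>y. y \<in> ?K \<Longrightarrow> \<bar>G y\<bar> \<le> B"
    unfolding bounded_iff real_norm_def by blast
  have "\<exists>p. real_polynomial_function p \<and> (\<forall>y\<in>?K. \<bar>G y - p y\<bar> < 1 / (real k + 1))" for k
    by (rule Stone_Weierstrass_real_polynomial_function[OF compact_cball cont, of "1 / (real k + 1)"]) auto
  then obtain p where p: "\<And>k. real_polynomial_function (p k)"
    "\<And>k y. y \<in> ?K \<Longrightarrow> \<bar>G y - p k y\<bar> < 1 / (real k + 1)"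
    by metis
  show ?thesis
  proof (rule hermite_closure_limit[where F="\<lambda>k x. of_real (p k (gauss_embed x))" and w="\<lambda>_. B + 1"])
    show "(\<lambda>x::real^'n. of_real (p k (gauss_embed x))) \<in> hermite_closure" for k
      by (rule hermite_closure_polynomial_embed[OF p(1)])
    show "(\<lambda>k. of_real (p k (gauss_embed x)) :: complex) \<longlonglongrightarrow> of_real (G (gauss_embed x))" for x :: "real^'n"
    proof (rule tendsto_of_real, rule metric_LIMSEQ_I)
      fix r :: real assume "r > 0"
      then obtain N where N: "1 / (real N + 1) < r"
        using nat_approx_posE[of r] by (auto simp: add.commute)
      have "dist (p k (gauss_embed x)) (G (gauss_embed x)) < r" if "k \<ge> N" for k
      proof -
        have "dist (p k (gauss_embed x)) (G (gauss_embed x)) < 1 / (real k + 1)"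
          using p(2)[OF gauss_embed_bounded] by (simp add: dist_real_def abs_minus_commute)
        also have "\<dots> \<le> 1 / (real N + 1)"
          using that by (intro divide_left_mono) auto
        finally show ?thesis using N by simp
      qed
      then show "\<exists>N. \<forall>k\<ge>N. dist (p k (gauss_embed x)) (G (gauss_embed x)) < r" by blast
    qed
    show "cmod (of_real (p k (gauss_embed x))) \<le> B + 1" for k and x :: "real^'n"
    proof -
      have "\<bar>G (gauss_embed x) - p k (gauss_embed x)\<bar> < 1 / (real k + 1)"
        by (rule p(2)[OF gauss_embed_bounded])
      also have "\<dots> \<le> 1" by simp
      finally show ?thesis
        using B[OF gauss_embed_bounded[of x]] by simp
    qed
  qed simp
qed

lemma continuous_gauss_embed: "continuous_on UNIV gauss_embed"
  unfolding gauss_embed_def[abs_def] gexp_def by (intro continuous_intros) auto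

lemma inj_gauss_embed: "inj gauss_embed"
  by (rule injI) (auto simp: gauss_embed_def gexp_def)

text \<open>Since \<open>gauss_embed\<close> is continuous and injective, a compact set is the preimage of its own compact
image, and the indicator function of a closed set is a decreasing limit of continuous functions
of the distance to it.\<close>

lemma hermite_closure_compact:
  fixes C :: "(real ^ 'n) set"
  assumes "compact C"
  shows "(\<lambda>x. indicator C x) \<in> hermite_closure"
proof (cases "C = {}")
  case True
  then show ?thesis
    using hermite_closure_sum[of "{}"] by simp
next
  case False
  let ?K = "gauss_embed ` C"
  have K: "closed ?K" "?K \<noteq> {}"
    using assms False
    by (auto intro!: compact_imp_closed compact_continuous_image continuous_on_subset[OF continuous_gauss_embed])
  have mem: "gauss_embed x \<in> ?K \<longleftrightarrow> x \<in> C" for x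
    using inj_image_mem_iff[OF inj_gauss_embed] .
  show ?thesis
  proof (rule hermite_closure_limit[where w="\<lambda>_. 1" and
        F="\<lambda>k x. of_real (max 0 (1 - real k * infdist (gauss_embed x) ?K))"])
    show "(\<lambda>x. of_real (max 0 (1 - real k * infdist (gauss_embed x) ?K))) \<in> hermite_closure" for k
      by (rule hermite_closure_continuous_embed) (intro continuous_intros)
    show "(\<lambda>k. of_real (max 0 (1 - real k * infdist (gauss_embed x) ?K)) :: complex)
        \<longlonglongrightarrow> indicator C x" for x
    proof (cases "x \<in> C")
      case True
      then have "infdist (gauss_embed x) ?K = 0" by (intro infdist_zero) simp
      then show ?thesis using True by simp
    next
      case x: False
      then have "infdist (gauss_embed x) ?K \<noteq> 0"
        unfolding in_closed_iff_infdist_zero[OF K, symmetric] mem .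
      then have pos: "infdist (gauss_embed x) ?K > 0"
        unfolding less_le using infdist_nonneg[of "gauss_embed x" ?K] by (simp only: simp_thms eq_commute)
      have "eventually (\<lambda>k. max 0 (1 - real k * infdist (gauss_embed x) ?K) = 0) sequentially"
      proof -
        obtain N where N: "1 < real N * infdist (gauss_embed x) ?K"
          using reals_Archimedean3[OF pos] by blast
        have "real N * infdist (gauss_embed x) ?K \<le> real k * infdist (gauss_embed x) ?K" if "k \<ge> N" for k
          using that pos by (intro mult_right_mono) auto
        with N have "max 0 (1 - real k * infdist (gauss_embed x) ?K) = 0" if "k \<ge> N" for k
          using that by (smt (verit))
        then show ?thesis
          unfolding eventually_sequentially by blast
      qed
      then have "eventually (\<lambda>k. of_real (max 0 (1 - real k * infdist (gauss_embed x) ?K)) = (indicator C x :: complex)) sequentially"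
        using x by (auto elim!: eventually_mono)
      then show ?thesis by (rule tendsto_eventually)
    qed
    show "cmod (of_real (max 0 (1 - real k * infdist (gauss_embed x) ?K))) \<le> 1" for k x
    proof -
      have "real k * infdist (gauss_embed x) ?K \<ge> 0"
        by (intro mult_nonneg_nonneg infdist_nonneg of_nat_0_le_iff)
      then show ?thesis
        unfolding norm_of_real by linarith
    qed
  qed simp
qed

lemma hermite_closure_closed:
  fixes C :: "(real ^ 'n) set"
  assumes "closed C"
  shows "(\<lambda>x. indicator C x) \<in> hermite_closure"
proof (rule hermite_closure_limit[where w="\<lambda>_. 1" and F="\<lambda>k. indicator (C \<inter> cball 0 (real k))"])
  show "(indicator (C \<inter> cball 0 (real k)) :: real^'n \<Rightarrow> complex) \<in> hermite_closure" for k
    by (rule hermite_closure_compact) (intro closed_Int_compact assms compact_cball)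
  show "(\<lambda>k. indicator (C \<inter> cball 0 (real k)) x :: complex) \<longlonglongrightarrow> indicator C x" for x
  proof (rule tendsto_eventually)
    obtain N where "norm x \<le> real N" using real_arch_simple by blast
    then show "eventually (\<lambda>k. indicator (C \<inter> cball 0 (real k)) x = (indicator C x :: complex)) sequentially"
      unfolding eventually_sequentially by (intro exI[of _ N]) (auto simp: indicator_def)
  qed
qed (auto simp: indicator_def)

lemma hermite_closure_borel:
  fixes A :: "(real ^ 'n) set"
  assumes "A \<in> sets borel"
  shows "(\<lambda>x. indicator A x) \<in> hermite_closure"
proof -
  have "Int_stable (Collect closed :: (real ^ 'n) set set)"
    by (auto simp: Int_stable_def)
  moreover have "Collect closed \<subseteq> Pow (UNIV :: (real ^ 'n) set)"
    by simp
  moreover have "A \<in> sigma_sets UNIV (Collect closed)"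
    using assms by (simp add: borel_eq_closed)
  ultimately show ?thesis
  proof (induction A rule: sigma_sets_induct_disjoint)
    case (basic A)
    then show ?case by (simp add: hermite_closure_closed)
  next
    case empty
    show ?case using hermite_closure_closed[of "{}"] by simp
  next
    case (compl A)
    have "(\<lambda>x. indicator UNIV x + (-1) * indicator A x) \<in> hermite_closure"
      by (intro hermite_closure_add hermite_closure_cmult compl.IH hermite_closure_closed closed_UNIV)
    also have "(\<lambda>x. indicator UNIV x + (-1) * indicator A x :: complex) = indicator (UNIV - A)"
      by (auto simp: indicator_def fun_eq_iff)
    finally show ?case .
  next
    case (union A)
    show ?case
    proof (rule hermite_closure_limit[where w="\<lambda>_. 1" and F="\<lambda>N x. \<Sum>i<N. indicator (A i) x"])
      show "(\<lambda>x. \<Sum>i<N. indicator (A i) x) \<in> hermite_closure" for N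
        by (intro hermite_closure_sum union.IH)
      have eq: "(\<Sum>i<N. indicator (A i) x) = (indicator (\<Union>i<N. A i) x :: complex)" for N x
        using union.hyps(1) by (intro indicator_UN_disjoint[symmetric]) (auto simp: disjoint_family_on_def)
      show "cmod (\<Sum>i<N. indicator (A i) x) \<le> 1" for N x
        unfolding eq by (simp add: indicator_def)
      show "(\<lambda>N. \<Sum>i<N. indicator (A i) x :: complex) \<longlonglongrightarrow> indicator (\<Union>i. A i) x" for x
        unfolding eq by (rule LIMSEQ_indicator_UN)
    qed simp
  qed
qed

text \<open>Completeness of the Hermite polynomials: every function in \<open>L\<^sup>2(\<gamma>)\<close> is a dominated limit of simple
functions, and indicator functions of Borel sets are in the closed span.\<close>

theorem L2_subset_hermite_closure:
  fixes f :: "real ^ 'n \<Rightarrow> complex"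
  assumes "f \<in> L2"
  shows "f \<in> hermite_closure"
proof -
  obtain F where F: "\<And>i. simple_function gauss (F i)" "\<And>x. (\<lambda>i. F i x) \<longlonglongrightarrow> f x"
    "\<And>i x. cmod (F i x) \<le> 2 * cmod (f x)"
    using borel_measurable_implies_sequence_metric[of f gauss 0] assms by (auto simp: L2_def)
  show ?thesis
  proof (rule hermite_closure_limit[where F=F, OF _ F(2) F(3)])
    show "integrable gauss (\<lambda>x. (2 * cmod (f x))\<^sup>2)"
      using L2_integrable[OF assms] by (simp add: power_mult_distrib)
    fix i
    have fin: "finite (range (F i))"
      using simple_functionD(1)[OF F(1)[of i]] by simp
    have "F i -` {y} \<in> sets borel" for y
      using simple_functionD(2)[OF F(1)[of i], of "{y}"] by simp
    then have "(\<lambda>x. \<Sum>y\<in>range (F i). y * indicator (F i -` {y}) x) \<in> hermite_closure"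
      by (intro hermite_closure_sum hermite_closure_cmult hermite_closure_borel)
    also have "(\<lambda>x. \<Sum>y\<in>range (F i). y * indicator (F i -` {y}) x) = F i"
      using fin by (simp add: fun_eq_iff indicator_def if_distrib sum.delta cong: if_cong)
    finally show "F i \<in> hermite_closure" .
  qed
qed

section \<open>Hermite expansions\<close>

abbreviation hermite_fun :: "('n::finite \<Rightarrow> nat) \<Rightarrow> real ^ 'n \<Rightarrow> complex" where
  "hermite_fun \<alpha> \<equiv> (\<lambda>x. of_real (hermite_mv \<alpha> x))"

lemma ip_hermite: "ip (hermite_fun \<alpha>) (hermite_fun \<beta>) = (if \<alpha> = \<beta> then of_real (hermite_sqnorm \<alpha>) else 0)"
proof -
  have "ip (hermite_fun \<alpha>) (hermite_fun \<beta>) = (\<integral>x. complex_of_real (hermite_mv \<alpha> x * hermite_mv \<beta> x) \<partial>gauss)"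
    by (simp add: ip_def)
  also have "\<dots> = of_real (\<integral>x. hermite_mv \<alpha> x * hermite_mv \<beta> x \<partial>gauss)"
    by (rule integral_complex_of_real)
  finally show ?thesis
    using hermite_mv_orthogonal[of \<alpha> \<beta>] unfolding has_bochner_integral_iff by auto
qed

lemma ip_commute: "ip g f = cnj (ip f g)"
proof -
  have eq: "(\<lambda>x. g x * cnj (f x)) = (\<lambda>x. cnj (f x * cnj (g x)))" by (simp add: mult.commute)
  show ?thesis unfolding ip_def eq by (rule Bochner_Integration.integral_cnj)
qed

lemma ip_diff_left: "f \<in> L2 \<Longrightarrow> g \<in> L2 \<Longrightarrow> h \<in> L2 \<Longrightarrow> ip (\<lambda>x. f x - g x) h = ip f h - ip g h"
  using integrable_ip[of f h] integrable_ip[of g h]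
  by (simp add: ip_def left_diff_distrib)

lemma ip_diff_right:
  assumes "f \<in> L2" "g \<in> L2" "h \<in> L2"
  shows "ip h (\<lambda>x. f x - g x) = ip h f - ip h g"
  unfolding ip_commute[of h] ip_diff_left[OF assms] complex_cnj_diff ..

lemma ip_sum_left:
  assumes "\<And>i. i \<in> I \<Longrightarrow> f i \<in> L2" "g \<in> L2"
  shows "ip (\<lambda>x. \<Sum>i\<in>I. c i * f i x) g = (\<Sum>i\<in>I. c i * ip (f i) g)"
proof -
  have "ip (\<lambda>x. \<Sum>i\<in>I. c i * f i x) g = (\<integral>x. (\<Sum>i\<in>I. c i * (f i x * cnj (g x))) \<partial>gauss)"
    by (simp add: ip_def sum_distrib_right mult.assoc)
  also have "\<dots> = (\<Sum>i\<in>I. \<integral>x. c i * (f i x * cnj (g x)) \<partial>gauss)"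
    using assms by (intro Bochner_Integration.integral_sum integrable_mult_right integrable_ip)
  finally show ?thesis by (simp add: ip_def)
qed

lemma ip_sum_right:
  assumes "\<And>i. i \<in> I \<Longrightarrow> f i \<in> L2" "g \<in> L2"
  shows "ip g (\<lambda>x. \<Sum>i\<in>I. c i * f i x) = (\<Sum>i\<in>I. cnj (c i) * ip g (f i))"
  using assms by (simp add: ip_commute[of g] ip_sum_left)

lemma nsq_ip: "ip f f = of_real (nsq f)"
  unfolding ip_def nsq_def complex_norm_square[symmetric] by (rule integral_complex_of_real)

lemma nsq_diff:
  assumes f: "f \<in> L2" and g: "g \<in> L2"
  shows "nsq (\<lambda>x. f x - g x) = nsq f - 2 * Re (ip f g) + nsq g"
proof -
  have fg: "(\<lambda>x. f x - g x) \<in> L2" using f g by (rule L2_diff)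
  have "ip (\<lambda>x. f x - g x) (\<lambda>x. f x - g x) = ip f f - ip f g - (ip g f - ip g g)"
    unfolding ip_diff_left[OF f g fg] ip_diff_right[OF f g f] ip_diff_right[OF f g g] ..
  from arg_cong[OF this, of Re] show ?thesis
    by (simp add: nsq_ip ip_commute[of g f])
qed

lemma ip_Cauchy_Schwarz:
  assumes f: "f \<in> L2" and g: "g \<in> L2"
  shows "(cmod (ip f g))\<^sup>2 \<le> nsq f * nsq g"
proof -
  have [measurable]: "f \<in> borel_measurable borel" "g \<in> borel_measurable borel"
    using f g by (auto dest: L2_D)
  have nsq: "(\<integral>\<^sup>+x. (ennreal (cmod (h x)))\<^sup>2 \<partial>gauss) = ennreal (nsq h)" if "h \<in> L2" for h :: "real ^ 'a \<Rightarrow> complex"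
    unfolding nsq_def ennreal_power[OF norm_ge_zero]
    by (rule nn_integral_eq_integral[OF L2_integrable[OF that]]) simp
  have "ennreal (cmod (ip f g)) \<le> ennreal (\<integral>x. cmod (f x * cnj (g x)) \<partial>gauss)"
    unfolding ip_def by (intro ennreal_leI integral_norm_bound)
  also have "\<dots> = (\<integral>\<^sup>+x. ennreal (cmod (f x * cnj (g x))) \<partial>gauss)"
    by (rule nn_integral_eq_integral[OF integrable_norm[OF integrable_ip[OF f g]], symmetric]) simp
  also have "\<dots> = (\<integral>\<^sup>+x. ennreal (cmod (f x)) * ennreal (cmod (g x)) \<partial>gauss)"
    by (simp add: norm_mult ennreal_mult)
  finally have "(ennreal (cmod (ip f g)))\<^sup>2 \<le> (\<integral>\<^sup>+x. ennreal (cmod (f x)) * ennreal (cmod (g x)) \<partial>gauss)\<^sup>2"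
    by (rule power_mono) simp
  also have "\<dots> \<le> (\<integral>\<^sup>+x. (ennreal (cmod (f x)))\<^sup>2 \<partial>gauss) * (\<integral>\<^sup>+x. (ennreal (cmod (g x)))\<^sup>2 \<partial>gauss)"
    by (rule Cauchy_Schwarz_nn_integral) measurable
  also have "\<dots> = ennreal (nsq f * nsq g)"
    unfolding nsq[OF f] nsq[OF g] by (rule ennreal_mult[symmetric]) (rule nsq_nonneg)+
  finally show ?thesis
    by (simp add: ennreal_power nsq_nonneg)
qed

lemma ip_tendsto_0:
  assumes v: "\<And>k. v k \<in> L2" and f: "f \<in> L2" and lim: "(\<lambda>k. nsq (v k)) \<longlonglongrightarrow> 0"
  shows "(\<lambda>k. ip (v k) f) \<longlonglongrightarrow> 0"
proof -
  have "(\<lambda>k. (cmod (ip (v k) f))\<^sup>2) \<longlonglongrightarrow> 0"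
  proof (rule tendsto_sandwich[OF _ _ tendsto_const])
    show "(\<lambda>k. nsq (v k) * nsq f) \<longlonglongrightarrow> 0"
      using tendsto_mult_right[OF lim, of "nsq f"] by simp
  qed (auto intro!: always_eventually ip_Cauchy_Schwarz v f)
  then have "(\<lambda>k. sqrt ((cmod (ip (v k) f))\<^sup>2)) \<longlonglongrightarrow> sqrt 0"
    by (rule tendsto_real_sqrt)
  then show ?thesis
    by (simp add: tendsto_norm_zero_iff)
qed

definition hermite_coeff :: "(real ^ 'n \<Rightarrow> complex) \<Rightarrow> ('n \<Rightarrow> nat) \<Rightarrow> complex" where
  "hermite_coeff f \<alpha> = ip f (hermite_fun \<alpha>) / of_real (hermite_sqnorm \<alpha>)"

lemma ip_eq_hermite_coeff: "ip f (hermite_fun \<alpha>) = hermite_coeff f \<alpha> * of_real (hermite_sqnorm \<alpha>)"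
  using hermite_sqnorm_pos[of \<alpha>] by (simp add: hermite_coeff_def)

lemma ip_hermite_sum:
  assumes "finite A"
  shows "ip (\<lambda>x. \<Sum>\<alpha>\<in>A. b \<alpha> * hermite_fun \<alpha> x) (hermite_fun \<beta>)
    = (if \<beta> \<in> A then b \<beta> * of_real (hermite_sqnorm \<beta>) else 0)"
  unfolding ip_sum_left[OF hermite_L2 hermite_L2] ip_hermite
  using assms by (simp add: if_distrib[of "(*) _"] cong: if_cong)

lemma Q_eq:
  fixes f :: "real ^ 'n \<Rightarrow> complex"
  assumes f: "f \<in> L2"
  shows "Q k f = (\<lambda>x. \<Sum>\<alpha> | (\<Sum>i\<in>UNIV. \<alpha> i) = k. hermite_coeff f \<alpha> * hermite_fun \<alpha> x)"
proof -
  let ?A = "{\<alpha> :: 'n \<Rightarrow> nat. (\<Sum>i\<in>UNIV. \<alpha> i) = k}"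
  have S: "(\<lambda>x. \<Sum>\<alpha>\<in>?A. b \<alpha> * hermite_fun \<alpha> x) \<in> L2" for b
    by (intro L2_sum L2_cmult hermite_L2)
  have ip: "ip (\<lambda>x. f x - (\<Sum>\<alpha>\<in>?A. b \<alpha> * hermite_fun \<alpha> x)) (hermite_fun \<beta>)
      = (hermite_coeff f \<beta> - b \<beta>) * of_real (hermite_sqnorm \<beta>)" if "\<beta> \<in> ?A" for b \<beta>
    unfolding ip_diff_left[OF f S hermite_L2] ip_hermite_sum[OF finite_multiindices] ip_eq_hermite_coeff
    using that by (simp add: left_diff_distrib)
  show ?thesis
    unfolding Q_def
  proof (rule the_equality, intro conjI ballI)
    show "(\<lambda>x. \<Sum>\<alpha>\<in>?A. hermite_coeff f \<alpha> * hermite_fun \<alpha> x) \<in> eigenspace k"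
      unfolding eigenspace_def by blast
    fix h :: "real ^ 'n \<Rightarrow> complex" assume "h \<in> eigenspace k"
    then obtain c where h: "h = (\<lambda>x. \<Sum>\<alpha>\<in>?A. c \<alpha> * hermite_fun \<alpha> x)"
      unfolding eigenspace_def by blast
    show "ip (\<lambda>x. f x - (\<Sum>\<alpha>\<in>?A. hermite_coeff f \<alpha> * hermite_fun \<alpha> x)) h = 0"
      unfolding h ip_sum_right[OF hermite_L2 L2_diff[OF f S]]
      by (rule sum.neutral) (simp add: ip del: mem_Collect_eq)
  next
    fix g assume g: "g \<in> eigenspace k \<and> (\<forall>h\<in>eigenspace k. ip (\<lambda>x. f x - g x) h = 0)"
    then obtain b where b: "g = (\<lambda>x. \<Sum>\<alpha>\<in>?A. b \<alpha> * hermite_fun \<alpha> x)"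
      unfolding eigenspace_def by blast
    have "b \<beta> = hermite_coeff f \<beta>" if \<beta>: "\<beta> \<in> ?A" for \<beta>
    proof -
      have "(\<Sum>\<alpha>\<in>?A. (if \<alpha> = \<beta> then 1 else 0) * hermite_fun \<alpha> x)
          = (\<Sum>\<alpha>\<in>?A. if \<alpha> = \<beta> then hermite_fun \<alpha> x else 0)" for x
        by (intro sum.cong) auto
      then have "hermite_fun \<beta> = (\<lambda>x. \<Sum>\<alpha>\<in>?A. (if \<alpha> = \<beta> then 1 else 0) * hermite_fun \<alpha> x)"
        unfolding sum.delta[OF finite_multiindices] using \<beta> by simp
      then have "hermite_fun \<beta> \<in> eigenspace k"
        unfolding eigenspace_def by (rule range_eqI[where x="\<lambda>\<alpha>. if \<alpha> = \<beta> then 1 else 0"])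
      then have "ip (\<lambda>x. f x - g x) (hermite_fun \<beta>) = 0" using g by blast
      then show ?thesis
        unfolding b ip[OF \<beta>] using hermite_sqnorm_pos[of \<beta>] by simp
    qed
    then show "g = (\<lambda>x. \<Sum>\<alpha>\<in>?A. hermite_coeff f \<alpha> * hermite_fun \<alpha> x)"
      unfolding b by (intro ext sum.cong) simp_all
  qed
qed

text \<open>The contribution of one Hermite polynomial to the squared norm of \<open>f\<close>; the sum over all
multi-indices of degree \<open>k\<close> is the squared norm of \<open>Q k f\<close>.\<close>

definition hermite_weight :: "(real ^ 'n \<Rightarrow> complex) \<Rightarrow> ('n \<Rightarrow> nat) \<Rightarrow> real" where
  "hermite_weight f \<alpha> = (cmod (hermite_coeff f \<alpha>))\<^sup>2 * hermite_sqnorm \<alpha>"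

lemma hermite_weight_nonneg: "hermite_weight f \<alpha> \<ge> 0"
  unfolding hermite_weight_def using hermite_sqnorm_pos[of \<alpha>] by simp

lemma Q_L2: "f \<in> L2 \<Longrightarrow> Q k f \<in> L2"
  unfolding Q_eq by (intro L2_sum L2_cmult hermite_L2)

lemma ip_Q:
  assumes f: "f \<in> L2"
  shows "ip (Q k f) f = of_real (\<Sum>\<alpha> | (\<Sum>i\<in>UNIV. \<alpha> i) = k. hermite_weight f \<alpha>)"
proof -
  have "hermite_coeff f \<alpha> * ip (hermite_fun \<alpha>) f = of_real (hermite_weight f \<alpha>)" for \<alpha>
    unfolding ip_commute[of "hermite_fun \<alpha>" f] ip_eq_hermite_coeff hermite_weight_def of_real_mult complex_norm_square
    by (simp add: mult.assoc)
  then show ?thesis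
    unfolding Q_eq[OF f] ip_sum_left[OF hermite_L2 f] by (simp only: of_real_sum)
qed

text \<open>By orthogonality the difference of the two sides is a sum of squares
\<open>(cmod (hermite_coeff f \<alpha> - b \<alpha>))\<^sup>2\<close> with positive weights. This way of stating the best
approximation property turns density of the span into a lower bound for the squared norms of the
projections, without forming the limit of the Hermite expansion.\<close>

lemma nsq_le_approximation_error:
  assumes f: "f \<in> L2" and A: "finite A"
  shows "nsq f \<le> nsq (\<lambda>x. f x - (\<Sum>\<alpha>\<in>A. b \<alpha> * hermite_fun \<alpha> x)) + (\<Sum>\<alpha>\<in>A. hermite_weight f \<alpha>)"
proof -
  let ?g = "\<lambda>x. \<Sum>\<alpha>\<in>A. b \<alpha> * hermite_fun \<alpha> x"
  have g: "?g \<in> L2" by (intro L2_sum L2_cmult hermite_L2)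
  have "Re (ip f ?g) = (\<Sum>\<alpha>\<in>A. Re (cnj (b \<alpha>) * hermite_coeff f \<alpha>) * hermite_sqnorm \<alpha>)"
    unfolding ip_sum_right[OF hermite_L2 f] ip_eq_hermite_coeff mult.assoc[symmetric] Re_sum
    by (simp add: left_diff_distrib)
  moreover have "nsq ?g = (\<Sum>\<alpha>\<in>A. (cmod (b \<alpha>))\<^sup>2 * hermite_sqnorm \<alpha>)"
  proof -
    have "ip ?g ?g = (\<Sum>\<alpha>\<in>A. (b \<alpha> * cnj (b \<alpha>)) * of_real (hermite_sqnorm \<alpha>))"
      unfolding ip_sum_right[OF hermite_L2 g] ip_hermite_sum[OF A] by (intro sum.cong) simp_all
    also have "\<dots> = of_real (\<Sum>\<alpha>\<in>A. (cmod (b \<alpha>))\<^sup>2 * hermite_sqnorm \<alpha>)"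
      unfolding of_real_sum of_real_mult complex_norm_square ..
    finally show ?thesis unfolding nsq_ip of_real_eq_iff .
  qed
  moreover have "0 \<le> (\<Sum>\<alpha>\<in>A. hermite_weight f \<alpha> - 2 * (Re (cnj (b \<alpha>) * hermite_coeff f \<alpha>) * hermite_sqnorm \<alpha>)
      + (cmod (b \<alpha>))\<^sup>2 * hermite_sqnorm \<alpha>)"
  proof (rule sum_nonneg)
    fix \<alpha>
    have "0 \<le> (cmod (hermite_coeff f \<alpha> - b \<alpha>))\<^sup>2 * hermite_sqnorm \<alpha>"
      using hermite_sqnorm_pos[of \<alpha>] by simp
    also have "(cmod (hermite_coeff f \<alpha> - b \<alpha>))\<^sup>2 = (cmod (hermite_coeff f \<alpha>))\<^sup>2
        - 2 * Re (cnj (b \<alpha>) * hermite_coeff f \<alpha>) + (cmod (b \<alpha>))\<^sup>2"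
      unfolding cmod_power2 by (simp add: power2_eq_square algebra_simps)
    finally show "0 \<le> hermite_weight f \<alpha> - 2 * (Re (cnj (b \<alpha>) * hermite_coeff f \<alpha>) * hermite_sqnorm \<alpha>)
      + (cmod (b \<alpha>))\<^sup>2 * hermite_sqnorm \<alpha>"
      unfolding hermite_weight_def by (simp add: algebra_simps)
  qed
  ultimately show ?thesis
    unfolding nsq_diff[OF f g] by (simp add: sum.distrib sum_subtractf sum_distrib_left)
qed

lemma nsq_le_sum_projections:
  fixes f :: "real ^ 'n \<Rightarrow> complex"
  assumes f: "f \<in> L2" and e: "e > 0"
  obtains N where "nsq f \<le> e + (\<Sum>k<N. \<Sum>\<alpha> | (\<Sum>i\<in>UNIV. \<alpha> i) = k. hermite_weight f \<alpha>)"
proof -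
  obtain g where "g \<in> hermite_span" and g: "nsq (\<lambda>x. f x - g x) < e"
    using L2_subset_hermite_closure[OF f] e unfolding hermite_closure_def by blast
  then obtain A b where A: "finite A" and gA: "g = (\<lambda>x. \<Sum>\<alpha>\<in>A. b \<alpha> * hermite_fun \<alpha> x)"
    unfolding hermite_span_def by blast
  define N where "N = Suc (\<Sum>\<alpha>\<in>A. \<Sum>i\<in>UNIV. \<alpha> i)"
  have N: "(\<Sum>i\<in>UNIV. \<alpha> i) < N" if "\<alpha> \<in> A" for \<alpha>
    using member_le_sum[OF that _ A, of "\<lambda>\<alpha>. \<Sum>i\<in>UNIV. \<alpha> i"] by (simp add: N_def)
  let ?B = "\<Union>k<N. {\<alpha> :: 'n \<Rightarrow> nat. (\<Sum>i\<in>UNIV. \<alpha> i) = k}"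
  have "nsq f \<le> e + (\<Sum>\<alpha>\<in>A. hermite_weight f \<alpha>)"
    using nsq_le_approximation_error[OF f A, of b] g unfolding gA by linarith
  also have "(\<Sum>\<alpha>\<in>A. hermite_weight f \<alpha>) \<le> (\<Sum>\<alpha>\<in>?B. hermite_weight f \<alpha>)"
    using N by (intro sum_mono2) (auto simp: finite_multiindices hermite_weight_nonneg)
  also have "\<dots> = (\<Sum>k<N. \<Sum>\<alpha> | (\<Sum>i\<in>UNIV. \<alpha> i) = k. hermite_weight f \<alpha>)"
    by (intro sum.UNION_disjoint) (auto simp: finite_multiindices)
  finally show ?thesis using that by simp
qed

section \<open>Monotonicity of the spectral multiplier\<close>

text \<open>The points \<open>y + s\<close> and \<open>y + t\<close> lie between \<open>y\<close> and \<open>y + s + t\<close> and have the same sum as these, so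
convexity of \<open>ln \<circ> Gamma\<close> compares the sums of the values.\<close>

lemma Gamma_ratio_mono:
  fixes y s t :: real
  assumes "y > 0" "s > 0" "t \<ge> 0"
  shows "Gamma (y + s) / Gamma y \<le> Gamma (y + t + s) / Gamma (y + t)"
proof (cases "t = 0")
  case False
  with assms have t: "t > 0" by simp
  \<comment> \<open>\<open>y + s\<close> and \<open>y + t\<close> are the convex combinations of the end points with parameters \<open>l\<close> and \<open>1 - l\<close>.\<close>
  define l where "l = s / (s + t)"
  have l: "0 \<le> l" "l \<le> 1" "l * (s + t) = s"
    using assms t by (auto simp: l_def)
  let ?g = "ln \<circ> Gamma :: real \<Rightarrow> real"
  have "?g ((1 - u) *\<^sub>R y + u *\<^sub>R (y + s + t)) \<le> (1 - u) * ?g y + u * ?g (y + s + t)" if "0 \<le> u" "u \<le> 1" for u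
    using assms that by (intro convex_onD[OF log_convex_Gamma_real]) auto
  from this[of l] this[of "1 - l"] l
  have "?g (y + s) + ?g (y + t) \<le> ?g y + ?g (y + s + t)"
    by (simp add: algebra_simps)
  moreover have pos: "Gamma y > 0" "Gamma (y + s) > 0" "Gamma (y + t) > 0" "Gamma (y + s + t) > 0"
    using assms by (auto intro!: Gamma_real_pos)
  ultimately have "ln (Gamma (y + s) * Gamma (y + t)) \<le> ln (Gamma y * Gamma (y + s + t))"
    by (simp add: ln_mult)
  then have "Gamma (y + s) * Gamma (y + t) \<le> Gamma y * Gamma (y + s + t)"
    using pos by (subst (asm) ln_le_cancel_iff) auto
  then show ?thesis
    using pos by (simp add: field_simps add_ac)
qed simp

lemma U_coeff_0_le:
  assumes "0 < s" "s < 1"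
  shows "U_coeff d s 0 \<le> U_coeff d s k"
proof -
  have "2 powr s * (Gamma ((real d / 2 + 1 - s) / 2 + s) / Gamma ((real d / 2 + 1 - s) / 2))
    \<le> 2 powr s * (Gamma ((real d / 2 + 1 - s) / 2 + real k / 2 + s) / Gamma ((real d / 2 + 1 - s) / 2 + real k / 2))"
    using assms by (intro mult_left_mono Gamma_ratio_mono) auto
  then show ?thesis
    unfolding U_coeff_def by (simp add: field_simps)
qed

lemma U_coeff_pos:
  assumes "0 < s" "s < 1"
  shows "U_coeff d s k > 0"
  unfolding U_coeff_def using assms
  by (intro divide_pos_pos mult_pos_pos Gamma_real_pos) auto

section \<open>The quadratic form of the fractional power\<close>

text \<open>Convergence in \<open>L\<^sup>2(\<gamma>)\<close> passes to inner products with \<open>f\<close>, which turns the series for \<open>u\<close> into a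
numerical series with real terms.\<close>

lemma has_U_ip:
  fixes f u :: "real ^ 'n \<Rightarrow> complex"
  assumes f: "f \<in> L2" and u: "has_U s f u"
  shows "(\<lambda>N. complex_of_real (\<Sum>k<N. U_coeff CARD('n) s k * (\<Sum>\<alpha> | (\<Sum>i\<in>UNIV. \<alpha> i) = k. hermite_weight f \<alpha>)))
    \<longlonglongrightarrow> ip u f"
proof -
  let ?c = "U_coeff CARD('n) s"
  let ?T = "\<lambda>N x. \<Sum>k<N. of_real (?c k) * Q k f x"
  have uL: "u \<in> L2" using u by (simp add: has_U_def)
  have T: "?T N \<in> L2" for N
    by (intro L2_sum L2_cmult Q_L2 f)
  have v: "(\<lambda>x. u x - ?T N x) \<in> L2" for N
    by (rule L2_diff[OF uL T])
  have "(\<integral>\<^sup>+x. ennreal ((cmod (u x - ?T N x))\<^sup>2) \<partial>gauss) = ennreal (nsq (\<lambda>x. u x - ?T N x))" for N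
    unfolding nsq_def by (rule nn_integral_eq_integral[OF L2_integrable[OF v]]) simp
  then have "(\<lambda>N. ennreal (nsq (\<lambda>x. u x - ?T N x))) \<longlonglongrightarrow> ennreal 0"
    using u by (simp add: has_U_def)
  then have "(\<lambda>N. nsq (\<lambda>x. u x - ?T N x)) \<longlonglongrightarrow> 0"
    by (subst (asm) tendsto_ennreal_iff) (auto simp: nsq_nonneg)
  from ip_tendsto_0[OF v f this] have "(\<lambda>N. ip u f - ip (?T N) f) \<longlonglongrightarrow> 0"
    unfolding ip_diff_left[OF uL T f] .
  from tendsto_diff[OF tendsto_const[of "ip u f"] this] have "(\<lambda>N. ip (?T N) f) \<longlonglongrightarrow> ip u f"
    by simp
  moreover have "ip (?T N) f = of_real (\<Sum>k<N. ?c k * (\<Sum>\<alpha> | (\<Sum>i\<in>UNIV. \<alpha> i) = k. hermite_weight f \<alpha>))" for N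
    unfolding ip_sum_left[OF Q_L2[OF f] f] ip_Q[OF f] by (simp only: of_real_sum of_real_mult)
  ultimately show ?thesis by simp
qed

text \<open>All terms of the series for \<open>ip u f\<close> are nonnegative, and its multipliers are at least the one in
degree zero, so that Parseval gives the bound.\<close>

lemma ip_U_ge:
  fixes f u :: "real ^ 'n \<Rightarrow> complex"
  assumes s: "0 < s" "s < 1" and f: "f \<in> L2" and u: "has_U s f u"
  shows "ip u f \<in> \<real>" and "U_coeff CARD('n) s 0 * nsq f \<le> Re (ip u f)"
proof -
  let ?c = "U_coeff CARD('n) s"
  define q where "q k = (\<Sum>\<alpha> | (\<Sum>i\<in>UNIV. \<alpha> i) = k. hermite_weight f \<alpha>)" for k
  have q: "q k \<ge> 0" for k
    unfolding q_def by (intro sum_nonneg hermite_weight_nonneg)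
  have lim: "(\<lambda>N. complex_of_real (\<Sum>k<N. ?c k * q k)) \<longlonglongrightarrow> ip u f"
    unfolding q_def by (rule has_U_ip[OF f u])
  show "ip u f \<in> \<real>"
    by (rule Lim_in_closed_set[OF closed_complex_Reals _ _ lim]) auto
  from tendsto_Re[OF lim] have limR: "(\<lambda>N. \<Sum>k<N. ?c k * q k) \<longlonglongrightarrow> Re (ip u f)"
    by simp
  have cq: "?c k * q k \<ge> 0" for k
    by (intro mult_nonneg_nonneg q less_imp_le[OF U_coeff_pos] s)
  have c0: "?c 0 > 0" using s by (rule U_coeff_pos)
  show "?c 0 * nsq f \<le> Re (ip u f)"
  proof (rule field_le_epsilon)
    fix e :: real assume e: "e > 0"
    obtain N where N: "nsq f \<le> e / ?c 0 + (\<Sum>k<N. q k)"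
      unfolding q_def using nsq_le_sum_projections[OF f, of "e / ?c 0"] e c0 by auto
    have "(\<Sum>k<N. ?c k * q k) \<le> Re (ip u f)"
    proof (rule LIMSEQ_le_const[OF limR], intro exI allI impI)
      fix M assume "N \<le> M"
      then show "(\<Sum>k<N. ?c k * q k) \<le> (\<Sum>k<M. ?c k * q k)"
        using cq by (intro sum_mono2) auto
    qed
    moreover have "?c 0 * (\<Sum>k<N. q k) \<le> (\<Sum>k<N. ?c k * q k)"
      unfolding sum_distrib_left by (intro sum_mono mult_right_mono U_coeff_0_le s q)
    moreover have "?c 0 * nsq f \<le> e + ?c 0 * (\<Sum>k<N. q k)"
      using mult_left_mono[OF N, of "?c 0"] c0 by (simp add: distrib_left)
    ultimately show "?c 0 * nsq f \<le> Re (ip u f) + e" by linarith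
  qed
qed

theorem corollary1p4:
  fixes f u :: "real ^ 'n \<Rightarrow> complex" and s \<rho> :: real
  assumes "0 < s" and "s < 1" and "0 < \<rho>"
    and "f \<in> L2" and "has_U s f u"
  shows "ip u f \<in> \<real> \<and>
    (\<integral>\<^sup>+x. ennreal ((cmod (f x))\<^sup>2 * (\<rho> + (norm x)\<^sup>2) powr s) \<partial>gauss) * ennreal (Re (ip u f))
      \<ge> ennreal ((2 * \<rho>) powr s
          * (Gamma ((real CARD('n) / 2 + 1 + s) / 2) / Gamma ((real CARD('n) / 2 + 1 - s) / 2))
          * (\<integral>x. (cmod (f x))\<^sup>2 \<partial>gauss)\<^sup>2)"
proof
  show "ip u f \<in> \<real>"
    by (rule ip_U_ge(1)[OF assms(1,2,4,5)])
  let ?c = "U_coeff CARD('n) s 0"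
  have "ennreal (\<rho> powr s * nsq f) = (\<integral>\<^sup>+x. ennreal (\<rho> powr s * (cmod (f x))\<^sup>2) \<partial>gauss)"
    unfolding nsq_def integral_mult_right_zero[symmetric]
    by (rule nn_integral_eq_integral[symmetric]) (auto intro: L2_integrable assms(4))
  also have "\<dots> \<le> (\<integral>\<^sup>+x. ennreal ((cmod (f x))\<^sup>2 * (\<rho> + (norm x)\<^sup>2) powr s) \<partial>gauss)"
  proof (rule nn_integral_mono, rule ennreal_leI)
    fix x :: "real ^ 'n"
    have "\<rho> powr s \<le> (\<rho> + (norm x)\<^sup>2) powr s"
      using assms by (intro powr_mono2) auto
    then show "\<rho> powr s * (cmod (f x))\<^sup>2 \<le> (cmod (f x))\<^sup>2 * (\<rho> + (norm x)\<^sup>2) powr s"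
      unfolding mult.commute[of "\<rho> powr s"] by (rule mult_left_mono) simp
  qed
  finally have "ennreal (\<rho> powr s * nsq f) * ennreal (?c * nsq f)
      \<le> (\<integral>\<^sup>+x. ennreal ((cmod (f x))\<^sup>2 * (\<rho> + (norm x)\<^sup>2) powr s) \<partial>gauss) * ennreal (Re (ip u f))"
    by (intro mult_mono ennreal_leI ip_U_ge(2)[OF assms(1,2,4,5)]) auto
  moreover have "ennreal (\<rho> powr s * nsq f) * ennreal (?c * nsq f)
      = ennreal ((2 * \<rho>) powr s
          * (Gamma ((real CARD('n) / 2 + 1 + s) / 2) / Gamma ((real CARD('n) / 2 + 1 - s) / 2))
          * (nsq f)\<^sup>2)"
  proof -
    have "ennreal (\<rho> powr s * nsq f) * ennreal (?c * nsq f) = ennreal ((\<rho> powr s * nsq f) * (?c * nsq f))"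
      using U_coeff_pos[OF assms(1,2), of "CARD('n)" 0]
      by (intro ennreal_mult[symmetric] mult_nonneg_nonneg nsq_nonneg) auto
    also have "(\<rho> powr s * nsq f) * (?c * nsq f) = (2 * \<rho>) powr s
          * (Gamma ((real CARD('n) / 2 + 1 + s) / 2) / Gamma ((real CARD('n) / 2 + 1 - s) / 2))
          * (nsq f)\<^sup>2"
      using assms by (simp add: U_coeff_def powr_mult power2_eq_square)
    finally show ?thesis .
  qed
  ultimately show "(\<integral>\<^sup>+x. ennreal ((cmod (f x))\<^sup>2 * (\<rho> + (norm x)\<^sup>2) powr s) \<partial>gauss) * ennreal (Re (ip u f))
      \<ge> ennreal ((2 * \<rho>) powr s
          * (Gamma ((real CARD('n) / 2 + 1 + s) / 2) / Gamma ((real CARD('n) / 2 + 1 - s) / 2))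
          * (\<integral>x. (cmod (f x))\<^sup>2 \<partial>gauss)\<^sup>2)"
    unfolding nsq_def by simp
qed

end
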